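(* Let $T=V_1-V_2$, where $V_1\sim\chi_r'^2(\lambda_1)$ and $V_2\sim\chi_r'^2(\lambda_2)$ are independent, with $r>0$ (real) and $\lambda_1,\lambda_2\geq0$. Let $W$ be a real-valued random variable such that $\mathbb{E}|W|<\infty$. For an integer $m\geq1$ let $\mathcal{F}_m$ be the class of functions $f:\mathbb{R}\rightarrow\mathbb{R}$ such that $f\in C^m(\mathbb{R})$ and such that $\mathbb{E}|f^{(j)}(T)|$, for $0\leq j\leq m-1$, and $\mathbb{E}|Tf^{(j)}(T)|$, for $0\leq j\leq m$, are finite (with $f^{(0)}\equiv f$). 1. Define the operator $A_1$ by $$A_1f(x)=16xf^{(4)}(x)+16rf^{(3)}(x)-\big(8x+4(\lambda_1-\lambda_2)\big)f''(x)-4(\lambda_1+\lambda_2+r)f'(x)+\big(x-(\lambda_1-\lambda_2)\big)f(x).$$ Then $W=_dT$ if and only if $\mathbb{E}[A_{1}f(W)]=0$ for all $f\in\mathcal{F}_4$. 2. Suppose that $\lambda_2=0$. Define the operator $A_2$ by $$A_{2}f(x)=8xf^{(3)}(x)+(8r-4x)f''(x)-(2x+4r+2\lambda_1)f'(x)+(x-\lambda_1)f(x).$$ Then $W=_dT$ if and only if $\mathbb{E}[A_{2}f(W)]=0$ for all $f\in\mathcal{F}_3$. 3. Suppose that $\lambda_1=\lambda_2=0$. Define the operator $A_3$ by $$A_{3}f(x)=4xf''(x)+4rf'(x)-xf(x).$$ Then $W=_dT$ if and only if $\mathbb{E}[A_{3}f(W)]=0$ for all $f\in\mathcal{F}_2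$.
   Context: $=_d$ denotes equality in distribution. For real $r>0$, the noncentral chi-square distribution $\chi_r'^2(\lambda)$ with $r$ degrees of freedom and noncentrality parameter $\lambda>0$ has density $p(x)=\frac{1}{2}\mathrm{e}^{-(x+\lambda)/2}(x/\lambda)^{r/4-1/2}I_{r/2-1}(\sqrt{\lambda x})$, $x\geq0$, where $I_\nu$ is the modified Bessel function of the first kind; $\chi_r'^2(0)$ is the chi-square distribution with $r$ degrees of freedom. (For integer $r$, $\chi_r'^2(\lambda)$ is the law of $\sum_{i=1}^rX_i^2$ with $X_i\sim N(\mu_i,1)$ independent and $\lambda=\sum_{i=1}^r\mu_i^2$.) *)

theory Defs
  imports "HOL-Probability.Probability"
begin

text \<open>
  The power series of the modified Bessel function of the first kind, for \<open>z > 0\<close>.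
  Since \<open>0 powr 0 = 0\<close>, the value at \<open>z = 0\<close> is \<open>0\<close> also for \<open>\<nu> = 0\<close> (where
  \<open>I\<^sub>0(0) = 1\<close>); in the density below this affects only the null set \<open>{0}\<close>.
\<close>

definition bessel_I :: "real \<Rightarrow> real \<Rightarrow> real" where
  "bessel_I \<nu> z = (\<Sum>k. (z / 2) powr (2 * real k + \<nu>) / (fact k * Gamma (real k + \<nu> + 1)))"

definition chi_square_density :: "real \<Rightarrow> real \<Rightarrow> real" where
  "chi_square_density r x =
     (if x < 0 then 0
      else x powr (r / 2 - 1) * exp (- x / 2) / (2 powr (r / 2) * Gamma (r / 2)))"

definition noncentral_chi_square_density :: "real \<Rightarrow> real \<Rightarrow> real \<Rightarrow> real" where
  "noncentral_chi_square_density r l x =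
     (if l = 0 then chi_square_density r x
      else if x < 0 then 0
      else 1 / 2 * exp (- (x + l) / 2) * (x / l) powr (r / 4 - 1 / 2)
             * bessel_I (r / 2 - 1) (sqrt (l * x)))"

text \<open>
  \<open>C_diff m f\<close> is \<open>f \<in> C\<^sup>m(\<real>)\<close>.  As \<open>deriv\<close> is total, differentiability of the
  derivatives of order below \<open>m\<close> has to be demanded explicitly.
\<close>

definition C_diff :: "nat \<Rightarrow> (real \<Rightarrow> real) \<Rightarrow> bool" where
  "C_diff m f \<longleftrightarrow>
     (\<forall>j<m. (deriv ^^ j) f differentiable_on UNIV) \<and> continuous_on UNIV ((deriv ^^ m) f)"

text \<open>
  \<open>T\<close> is a random variable on the probability space \<open>M\<close>; finiteness of \<open>E|X|\<close> is
  expressed as integrability of \<open>X\<close>.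
\<close>

definition stein_class :: "'a measure \<Rightarrow> ('a \<Rightarrow> real) \<Rightarrow> nat \<Rightarrow> (real \<Rightarrow> real) set" where
  "stein_class M T m =
     {f. C_diff m f \<and>
         (\<forall>j<m. integrable M (\<lambda>\<omega>. (deriv ^^ j) f (T \<omega>))) \<and>
         (\<forall>j\<le>m. integrable M (\<lambda>\<omega>. T \<omega> * (deriv ^^ j) f (T \<omega>)))}"

definition stein_op1 :: "real \<Rightarrow> real \<Rightarrow> real \<Rightarrow> (real \<Rightarrow> real) \<Rightarrow> real \<Rightarrow> real" where
  "stein_op1 r l1 l2 f x =
     16 * x * (deriv ^^ 4) f x + 16 * r * (deriv ^^ 3) f x
     - (8 * x + 4 * (l1 - l2)) * (deriv ^^ 2) f x
     - 4 * (l1 + l2 + r) * deriv f x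
     + (x - (l1 - l2)) * f x"

definition stein_op2 :: "real \<Rightarrow> real \<Rightarrow> (real \<Rightarrow> real) \<Rightarrow> real \<Rightarrow> real" where
  "stein_op2 r l1 f x =
     8 * x * (deriv ^^ 3) f x + (8 * r - 4 * x) * (deriv ^^ 2) f x
     - (2 * x + 4 * r + 2 * l1) * deriv f x
     + (x - l1) * f x"

definition stein_op3 :: "real \<Rightarrow> (real \<Rightarrow> real) \<Rightarrow> real \<Rightarrow> real" where
  "stein_op3 r f x = 4 * x * (deriv ^^ 2) f x + 4 * r * deriv f x - x * f x"

end

theory Submission
  imports Defs "HOL-Real_Asymp.Real_Asymp"
begin

text \<open>
  Write \<open>p\<^sub>s\<close> for the central chi-square density with \<open>s\<close> degrees of freedom, \<open>D\<close> for
  differentiation, \<open>S = 1 - 2 D\<close> and \<open>S' = 1 + 2 D\<close>.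

  Two elementary facts carry the identities: \<open>x p\<^sub>s(x) = s p\<^bsub>s+2\<^esub>(x)\<close>, so multiplication by \<open>x\<close> raises
  the degrees of freedom by two, and \<open>p\<^bsub>s+2\<^esub>' = (p\<^sub>s - p\<^bsub>s+2\<^esub>) / 2\<close>, which after integration by parts says
  that \<open>S\<close> lowers them again: \<open>E\<^bsub>s+2\<^esub> (S g) = E\<^sub>s g\<close>. The power series of the Bessel function exhibits the
  noncentral density as a Poisson mixture of \<open>p\<^bsub>r+2k\<^esub>\<close> over \<open>k\<close>, and summation turns the two facts into
  \<open>E\<^sub>r (x g) = r E\<^bsub>r+2\<^esub> g + \<lambda> E\<^bsub>r+4\<^esub> g\<close> and \<open>E\<^bsub>r+2\<^esub> (S g) = E\<^sub>r g\<close> at fixed noncentrality \<open>\<lambda>\<close>. Hence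
  \<open>E[V (S\<^sup>2 g)(V)] = r E[(S g)(V)] + \<lambda> E[g(V)]\<close>, and \<open>E[V (S g)(V)] = r E[g(V)]\<close> if \<open>\<lambda> = 0\<close>.

  For \<open>T = V1 - V2\<close> fix one variable and use independence. Since differentiating \<open>f(V1 - V2)\<close> in \<open>V2\<close>
  produces \<open>- D\<close>, the identity for \<open>V2\<close> involves \<open>S'\<close>. Applying the identity for \<open>V1\<close> to \<open>S'\<^sup>2 f\<close>, that for
  \<open>V2\<close> to \<open>S\<^sup>2 f\<close>, and subtracting, the factor \<open>V1 - V2\<close> becomes \<open>T\<close>:
  \<open>E[T (S\<^sup>2 S'\<^sup>2 f)(T)] = r E[(S S'\<^sup>2 - S' S\<^sup>2) f (T)] + \<lambda>\<^sub>1 E[(S'\<^sup>2 f)(T)] - \<lambda>\<^sub>2 E[(S\<^sup>2 f)(T)]\<close>.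
  Expanded, this is \<open>E[A\<^sub>1 f(T)] = 0\<close>. When a noncentrality parameter vanishes the shorter identity is
  available, one factor \<open>S\<close> or \<open>S'\<close> can be dropped, and the operators of order three and two result.

  These identities hold for \<open>f\<close> with bounded derivatives. A cutoff extends them to the whole test class:
  each error term contains a derivative of \<open>\<eta>(x / n)\<close>, which is \<open>O(1 / n)\<close> on \<open>\<bar>x\<bar> \<le> n\<close>, so that it
  absorbs a factor \<open>x\<close> and leaves an integrable multiple of some \<open>f\<^sup>(\<^sup>i\<^sup>)\<close> with \<open>i < m\<close>
  (\<open>stein_identity_extend\<close>).

  Conversely, sines and cosines belong to the test class. Testing \<open>W\<close> with them gives a linear differential
  equation \<open>P(i t) \<phi>'(t) = q(t) \<phi>(t)\<close> for its characteristic function, where \<open>P\<close> collects the coefficients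
  of \<open>x\<close> in the operator. \<open>T\<close> satisfies the same equation, and \<open>P(i t)\<close> has no real zero, because it is a
  product of factors \<open>1 - 2 i t\<close> and \<open>1 + 2 i t\<close>, up to sign. The initial value \<open>\<phi>(0) = 1\<close> therefore
  determines \<open>\<phi>\<close>, hence the law (\<open>real_distribution_stein_unique\<close>).
\<close>

section \<open>Central chi-square densities\<close>

lemma chi_square_density_measurable [measurable]:
  "chi_square_density s \<in> borel_measurable borel"
  unfolding chi_square_density_def[abs_def] by measurable

lemma chi_square_density_nonneg: "s > 0 \<Longrightarrow> 0 \<le> chi_square_density s x"
  by (auto simp: chi_square_density_def)

lemma has_bochner_integral_chi_square_density:
  assumes "s > 0"
  shows "has_bochner_integral lborel (chi_square_density s) 1"
proof -
  define g where "g = (\<lambda>t::real. indicator {0..} t * (t powr (s / 2 - 1) / exp t))"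
  have [measurable]: "g \<in> borel_measurable borel" unfolding g_def by measurable
  have "integral\<^sup>N lborel (\<lambda>t. ennreal (g t)) = ennreal (Gamma (s / 2))"
    unfolding g_def using assms
    by (intro nn_integral_has_integral_lebesgue Gamma_integral_real) auto
  hence "has_bochner_integral lborel g (Gamma (s / 2))"
    using assms by (intro has_bochner_integral_nn_integral) (auto simp: g_def intro!: less_imp_le)
  hence "has_bochner_integral lborel (\<lambda>u. (1 / (2 * Gamma (s / 2))) * g u)
      ((1 / (2 * Gamma (s / 2))) * Gamma (s / 2))"
    by (rule has_bochner_integral_mult_right)
  moreover have G: "Gamma (s / 2) > 0" using assms by simp
  moreover have "(\<lambda>u. (1 / (2 * Gamma (s / 2))) * g u) = (\<lambda>u. chi_square_density s (0 + 2 * u))"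
  proof
    fix u :: real
    have "chi_square_density s (0 + 2 * u) * (2 * Gamma (s / 2)) = g u"
      using powr_diff[of 2 "s / 2" 1] G
      by (auto simp: chi_square_density_def g_def powr_mult exp_minus divide_simps
          split: split_indicator)
    thus "(1 / (2 * Gamma (s / 2))) * g u = chi_square_density s (0 + 2 * u)"
      using G by (simp add: field_simps)
  qed
  ultimately have "has_bochner_integral lborel (\<lambda>u. chi_square_density s (0 + 2 * u)) (1 /\<^sub>R \<bar>2\<bar>)"
    by simp
  thus ?thesis
    by (subst lborel_has_bochner_integral_real_affine_iff[of 2 _ _ 0]) auto
qed

text \<open>
  The functional equation of the Gamma function absorbs the additional factor of the argument.
\<close>

lemma chi_square_density_times:
  assumes "s > 0"
  shows "x * chi_square_density s x = s * chi_square_density (s + 2) x"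
proof (cases "x < 0")
  case False
  have 1: "Gamma ((s + 2) / 2) = s / 2 * Gamma (s / 2)"
    using Gamma_plus1[of "s / 2"] nonpos_Ints_nonpos[of "s / 2"] assms
    by (auto simp: add_divide_distrib)
  have 2: "(2::real) powr ((s + 2) / 2) = 2 * 2 powr (s / 2)"
    by (simp add: add_divide_distrib powr_add)
  have 3: "x powr ((s + 2) / 2 - 1) = x * x powr (s / 2 - 1)"
    using False by (cases "x = 0") (auto simp: add_divide_distrib powr_diff)
  have "Gamma (s / 2) > 0" using assms by simp
  thus ?thesis
    unfolding chi_square_density_def 1 2 3 using assms False by (simp add: divide_simps)
qed (simp add: chi_square_density_def)

lemma chi_square_density_has_derivative:
  assumes "s > 0" "x > 0"
  shows "(chi_square_density (s + 2) has_real_derivative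
           (chi_square_density s x - chi_square_density (s + 2) x) / 2) (at x)"
proof -
  define c where "c = 2 powr ((s + 2) / 2) * Gamma ((s + 2) / 2)"
  have c: "c > 0" using assms by (simp add: c_def)
  have d2: "((\<lambda>x::real. exp (- x / 2)) has_real_derivative - (exp (- x / 2) / 2)) (at x)"
    by (auto intro!: derivative_eq_intros)
  have "((\<lambda>x. x powr (s / 2) * exp (- x / 2) / c) has_real_derivative
          (s / 2 * x powr (s / 2 - 1) * exp (- x / 2) - x powr (s / 2) * exp (- x / 2) / 2) / c) (at x)"
    by (rule DERIV_cong[OF DERIV_cdivide[OF DERIV_mult[OF
          has_real_derivative_powr[OF assms(2), of "s / 2"] d2], of c]]) simp
  also have "(s / 2 * x powr (s / 2 - 1) * exp (- x / 2) - x powr (s / 2) * exp (- x / 2) / 2) / c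
      = (s * (x powr (s / 2 - 1) * exp (- x / 2)/ c) - x powr (s / 2) * exp (- x / 2) / c) / 2"
    using c by (simp add: field_simps)
  also have "x powr (s / 2) * exp (- x / 2) / c = chi_square_density (s + 2) x"
    using assms by (simp add: chi_square_density_def c_def add_divide_distrib)
  also have "s * (x powr (s / 2 - 1) * exp (- x / 2)/ c) = chi_square_density s x"
  proof -
    have "x powr (s / 2) = x * x powr (s / 2 - 1)" using assms by (simp add: powr_diff)
    hence "x * (s * (x powr (s / 2 - 1) * exp (- x / 2)/ c)) = s * chi_square_density (s + 2) x"
      using assms by (simp add: chi_square_density_def c_def add_divide_distrib)
    also have "\<dots> = x * chi_square_density s x"
      using chi_square_density_times[OF assms(1)] by simp
    finally show ?thesis using assms(2) by (simp only: mult_cancel_left) simp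
  qed
  finally show ?thesis
    by (rule has_field_derivative_transform_within_open[where S = "{0<..}"])
       (use assms in \<open>auto simp: chi_square_density_def c_def add_divide_distrib\<close>)
qed

lemma integrable_chi_square_mult:
  fixes g :: "real \<Rightarrow> real"
  assumes "s > 0" and [measurable]: "g \<in> borel_measurable borel" and "\<And>x. \<bar>g x\<bar> \<le> C"
  shows "integrable lborel (\<lambda>x. chi_square_density s x * g x)"
proof (rule Bochner_Integration.integrable_bound)
  show "integrable lborel (\<lambda>x. C * chi_square_density s x)"
    using has_bochner_integral_chi_square_density[OF assms(1)] by (auto simp: has_bochner_integral_iff)
  show "AE x in lborel. norm (chi_square_density s x * g x) \<le> norm (C * chi_square_density s x)"
  proof (rule AE_I2)
    fix x show "norm (chi_square_density s x * g x) \<le> norm (C * chi_square_density s x)"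
      using assms(3)[of x] chi_square_density_nonneg[OF assms(1), of x]
      by (auto simp: abs_mult mult.commute[of C] intro!: mult_left_mono)
  qed
qed simp

text \<open>
  This is integration by parts for \<open>g\<close> against \<open>p\<^bsub>s+2\<^esub>\<close>, whose derivative is \<open>(p\<^sub>s - p\<^bsub>s+2\<^esub>) / 2\<close>. Raising the
  degrees of freedom to \<open>s + 2\<close> is what kills the boundary term at \<open>0\<close>: \<open>p\<^sub>s\<close> itself is unbounded there
  for \<open>s < 2\<close>, whereas \<open>p\<^bsub>s+2\<^esub>\<close> is a multiple of \<open>x\<^bsup>s/2\<^esup> exp (- x / 2)\<close>.
\<close>

lemma chi_square_shift:
  fixes g g' :: "real \<Rightarrow> real"
  assumes s: "s > 0"
    and g: "\<And>x. (g has_real_derivative g' x) (at x)" and g': "continuous_on UNIV g'"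
    and bg: "\<And>x. \<bar>g x\<bar> \<le> C" and bg': "\<And>x. \<bar>g' x\<bar> \<le> C"
  shows "(LBINT x. chi_square_density (s + 2) x * (g x - 2 * g' x))
       = (LBINT x. chi_square_density s x * g x)"
proof -
  let ?p = chi_square_density
  have cg: "continuous_on UNIV g"
    using g by (meson DERIV_isCont continuous_at_imp_continuous_on)
  have [measurable]: "g \<in> borel_measurable borel" "g' \<in> borel_measurable borel"
    using cg g' by (auto intro: borel_measurable_continuous_onI)
  define F where "F = (\<lambda>x. ?p (s + 2) x * g x)"
  define f where "f = (\<lambda>x. (?p s x * g x - ?p (s + 2) x * (g x - 2 * g' x)) / 2)"
  have bd: "\<bar>g x - 2 * g' x\<bar> \<le> 3 * C" for x using bg[of x] bg'[of x] by linarith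
  have int1: "integrable lborel (\<lambda>x. ?p s x * g x)"
    by (rule integrable_chi_square_mult[OF s _ bg]) simp
  have int2: "integrable lborel (\<lambda>x. ?p (s + 2) x * (g x - 2 * g' x))"
    by (rule integrable_chi_square_mult[OF _ _ bd]) (use s in auto)
  have intf: "integrable lborel f" unfolding f_def using int1 int2 by auto
  have lim: "(F \<longlongrightarrow> 0) L" if "(?p (s + 2) \<longlongrightarrow> 0) L" for L
  proof -
    have "((\<lambda>x. C * ?p (s + 2) x) \<longlongrightarrow> 0) L" using tendsto_mult_right_zero[OF that] by simp
    thus ?thesis
      by (rule Lim_null_comparison[rotated])
         (use bg chi_square_density_nonneg[of "s + 2"] s in
           \<open>auto simp: F_def abs_mult mult.commute intro!: always_eventually mult_right_mono\<close>)
  qed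
  define c where "c = 2 powr ((s + 2) / 2) * Gamma ((s + 2) / 2)"
  have c: "c > 0" using s by (simp add: c_def)
  have peq: "?p (s + 2) x = x powr (s / 2) * exp (- x / 2) / c" if "x > 0" for x
    using that by (simp add: chi_square_density_def c_def add_divide_distrib)
  have "((\<lambda>x. x powr (s / 2) * exp (- x / 2) / c) \<longlongrightarrow> 0) (at_right 0)"
    using s c by real_asymp
  hence l0: "(?p (s + 2) \<longlongrightarrow> 0) (at_right 0)"
    by (rule Lim_transform_eventually)
       (auto simp: peq eventually_at_right_less intro: eventually_mono[OF eventually_at_right_less])
  have "((\<lambda>x. x powr (s / 2) * exp (- x / 2) / c) \<longlongrightarrow> 0) at_top"
    using s c by real_asymp
  hence l1: "(?p (s + 2) \<longlongrightarrow> 0) at_top"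
    by (rule Lim_transform_eventually) (auto simp: peq intro: eventually_mono[OF eventually_gt_at_top[of 0]])
  have "(LBINT x=0..\<infinity>. f x) = 0 - 0"
  proof (rule interval_integral_FTC_integrable[where F = F])
    fix x :: real assume "0 < ereal x"
    hence x: "x > 0" by simp
    show "(F has_vector_derivative f x) (at x)"
      unfolding F_def f_def has_real_derivative_iff_has_vector_derivative[symmetric]
      by (rule derivative_eq_intros chi_square_density_has_derivative g s x refl)+ (simp add: field_simps)
    \<comment> \<open>Continuity of \<open>p\<^sub>s\<close> on the positive axis is inherited from \<open>p\<^bsub>s+2\<^esub>\<close> by dividing by the argument.\<close>
    have "isCont (?p s) x"
    proof -
      have "isCont (\<lambda>x. s * ?p (s + 2) x / x) x"
        using chi_square_density_has_derivative[OF s x, THEN DERIV_isCont] x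
        by (intro continuous_intros) auto
      moreover have "\<forall>\<^sub>F y in nhds x. s * ?p (s + 2) y / y = ?p s y"
        by (rule eventually_mono[OF eventually_nhds_in_open[of "{0<..}" x]])
           (use x in \<open>auto simp: chi_square_density_times[OF s, symmetric]\<close>)
      ultimately show ?thesis by (simp add: isCont_cong)
    qed
    thus "isCont f x"
      unfolding f_def
      using chi_square_density_has_derivative[OF s x, THEN DERIV_isCont] cg g'
      by (intro continuous_intros) (auto simp: continuous_on_eq_continuous_at)
  next
    show "set_integrable lborel (einterval 0 \<infinity>) f"
      using intf by (intro integrable_mult_indicator[where 'b=real, folded set_integrable_def]) auto
    show "((F \<circ> real_of_ereal) \<longlongrightarrow> 0) (at_right 0)"
      using lim[OF l0] by (simp add: zero_ereal_def ereal_tendsto_simps)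
    show "((F \<circ> real_of_ereal) \<longlongrightarrow> 0) (at_left \<infinity>)"
      using lim[OF l1] by (simp add: ereal_tendsto_simps)
  qed simp
  moreover have "(LBINT x=0..\<infinity>. f x) = (LBINT x. f x)"
    unfolding interval_lebesgue_integral_def set_lebesgue_integral_def
    using AE_lborel_singleton[of "0::real"]
    by (auto intro!: integral_cong_AE elim!: eventually_mono simp: f_def einterval_def chi_square_density_def split: split_indicator)
  ultimately have "(LBINT x. f x) = 0" by simp
  thus ?thesis unfolding f_def using int1 int2 by simp
qed

section \<open>Noncentral chi-square densities as Poisson mixtures\<close>

definition poisson_weight :: "real \<Rightarrow> nat \<Rightarrow> real" where
  "poisson_weight l k = exp (- l / 2) * (l / 2) ^ k / fact k"

lemma poisson_weight_nonneg: "l \<ge> 0 \<Longrightarrow> 0 \<le> poisson_weight l k"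
  by (simp add: poisson_weight_def)

lemma summable_poisson_weight_power: "summable (\<lambda>k. poisson_weight l k * c ^ k)"
proof -
  have "summable (\<lambda>k. exp (- l / 2) * (inverse (fact k) * (l / 2 * c) ^ k))"
    by (intro summable_mult summable_exp)
  moreover have "exp (- l / 2) * (inverse (fact k) * (l / 2 * c) ^ k) = poisson_weight l k * c ^ k" for k
    unfolding poisson_weight_def power_mult_distrib by (simp only: divide_inverse mult_ac)
  ultimately show ?thesis by (simp only:)
qed

text \<open>
  The size-biasing identity of the Poisson distribution with mean \<open>l / 2\<close>; it produces the noncentrality
  term when the mixture is multiplied by its argument.
\<close>

lemma poisson_weight_Suc: "2 * real (Suc k) * poisson_weight l (Suc k) = l * poisson_weight l k"
proof -
  have "fact (Suc k) = real (Suc k) * fact k" by simp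
  thus ?thesis by (simp add: poisson_weight_def field_simps del: of_nat_Suc fact_Suc)
qed

text \<open>
  Each step from \<open>s + 2 k\<close> to \<open>s + 2 (k + 1)\<close> multiplies the density by \<open>x / (s + 2 k) \<le> x / s\<close>. The geometric
  bound makes the mixture converge at every point.
\<close>

lemma chi_square_density_mixture_bound:
  assumes "s > 0" "x \<ge> 0"
  shows "chi_square_density (s + 2 * real k) x \<le> chi_square_density s x * (x / s) ^ k"
proof (induction k)
  case (Suc k)
  have s': "s + 2 * real k > 0" using assms by simp
  have "chi_square_density (s + 2 * real (Suc k)) x
      = x / (s + 2 * real k) * chi_square_density (s + 2 * real k) x"
    using chi_square_density_times[OF s', of x] s' by (simp add: field_simps)
  also have "\<dots> \<le> x / s * chi_square_density (s + 2 * real k) x"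
    using assms chi_square_density_nonneg[OF s'] by (intro mult_right_mono divide_left_mono) auto
  also have "\<dots> \<le> x / s * (chi_square_density s x * (x / s) ^ k)"
    using assms Suc by (intro mult_left_mono) auto
  finally show ?case by (simp add: mult_ac)
qed simp

lemma summable_chi_square_mixture:
  assumes s: "s > 0" and l: "l \<ge> 0"
  shows "summable (\<lambda>k. poisson_weight l k * chi_square_density (s + 2 * real k) x)"
proof (cases "x \<ge> 0")
  case True
  have "summable (\<lambda>k. chi_square_density s x * (poisson_weight l k * (x / s) ^ k))"
    by (intro summable_mult summable_poisson_weight_power)
  thus ?thesis
  proof (rule summable_comparison_test')
    fix k :: nat
    have "poisson_weight l k * chi_square_density (s + 2 * real k) x
        \<le> poisson_weight l k * (chi_square_density s x * (x / s) ^ k)"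
      using chi_square_density_mixture_bound[OF s True, of k] poisson_weight_nonneg[OF l]
      by (intro mult_left_mono)
    thus "norm (poisson_weight l k * chi_square_density (s + 2 * real k) x)
        \<le> chi_square_density s x * (poisson_weight l k * (x / s) ^ k)"
      using s chi_square_density_nonneg[of "s + 2 * real k" x] poisson_weight_nonneg[OF l, of k]
      by (simp add: mult_ac)
  qed
next
  case False
  hence "chi_square_density (s + 2 * real k) x = 0" for k
    by (simp add: chi_square_density_def)
  thus ?thesis by simp
qed

text \<open>
  The terms of the Bessel series are, after collecting powers of \<open>x\<close> and \<open>l\<close>, Poisson weights times central
  densities. The equality holds at every real \<open>x\<close>: at \<open>x = 0\<close> both sides vanish because \<open>0 powr a = 0\<close>, and
  for \<open>l = 0\<close> the Poisson weights degenerate to the indicator of \<open>k = 0\<close>.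
\<close>

lemma noncentral_chi_square_sums:
  assumes s: "s > 0" and l: "l \<ge> 0"
  shows "(\<lambda>k. poisson_weight l k * chi_square_density (s + 2 * real k) x)
           sums noncentral_chi_square_density s l x"
proof -
  consider "l = 0" | "x \<le> 0" "l > 0" | "x > 0" "l > 0" using l by linarith
  thus ?thesis
  proof cases
    assume "l = 0"
    hence "poisson_weight l k = (if k = 0 then 1 else 0)" for k by (simp add: poisson_weight_def)
    thus ?thesis
      using sums_single[of 0 "\<lambda>k. chi_square_density (s + 2 * real k) x"] \<open>l = 0\<close>
      by (simp add: noncentral_chi_square_density_def if_distrib[of "\<lambda>u. u * _"] cong: if_cong)
  next
    assume "x \<le> 0" "l > 0"
    thus ?thesis by (auto simp: noncentral_chi_square_density_def chi_square_density_def)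
  next
    assume x: "x > 0" and l: "l > 0"
    define c where "c = 1 / 2 * exp (- (x + l) / 2) * (x / l) powr (s / 4 - 1 / 2)"
    define t where "t = (\<lambda>k. (sqrt (l * x) / 2) powr (2 * real k + (s / 2 - 1))
                          / (fact k * Gamma (real k + (s / 2 - 1) + 1)))"
    have trm: "poisson_weight l k * chi_square_density (s + 2 * real k) x = c * t k" for k
    proof -
      \<comment> \<open>In terms of \<open>a\<close>, the exponent of \<open>x / l\<close>, all exponents are integer combinations of \<open>k\<close>, \<open>a\<close> and \<open>1\<close>.\<close>
      define a where "a = s / 4 - 1 / 2"
      have s_eq: "s = 4 * a + 2" by (simp add: a_def)
      have e: "real k + (s / 2 - 1) + 1 = real k + 2 * a + 1" using s_eq by linarith
      have "(sqrt (l * x) / 2) powr (2 * real k + (s / 2 - 1))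
          = (l * x) powr (real k + a) / 2 powr (2 * real k + 2 * a)"
        using x l by (simp add: powr_divide powr_half_sqrt[symmetric] powr_powr s_eq add_divide_distrib)
      also have "(l * x) powr (real k + a) = l ^ k * x ^ k * l powr a * x powr a"
        using x l by (simp add: powr_add powr_mult powr_realpow mult_ac)
      finally have t: "t k = l ^ k * x ^ k * l powr a * x powr a / 2 powr (2 * real k + 2 * a)
          / (fact k * Gamma (real k + 2 * a + 1))"
        by (simp only: t_def e)
      have "chi_square_density (s + 2 * real k) x
          = x powr (2 * a + real k) * exp (- x / 2) / (2 powr (2 * a + 1 + real k) * Gamma (real k + 2 * a + 1))"
        using x by (simp add: chi_square_density_def s_eq add_divide_distrib add_ac)
      also have "x powr (2 * a + real k) = x powr a * x powr a * x ^ k"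
        using x by (simp add: powr_add[symmetric] powr_realpow[symmetric])
      finally have p: "chi_square_density (s + 2 * real k) x
          = x powr a * x powr a * x ^ k * exp (- x / 2)
             / (2 powr (2 * a + 1 + real k) * Gamma (real k + 2 * a + 1))" .
      have c: "c = 1 / 2 * (exp (- x / 2) * exp (- l / 2)) * (x powr a / l powr a)"
        using x l by (simp add: c_def a_def powr_divide exp_add[symmetric] add_divide_distrib)
      have two: "(2::real) powr (2 * real k + 2 * a) = 2 ^ k * 2 powr (2 * a + 1 + real k) / 2"
      proof -
        have "2 * real k + 2 * a = real k + (2 * a + 1 + real k) - 1" by simp
        hence "(2::real) powr (2 * real k + 2 * a) = 2 powr (real k + (2 * a + 1 + real k) - 1)" by simp
        also have "\<dots> = 2 powr real k * 2 powr (2 * a + 1 + real k) / 2 powr 1"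
          by (simp only: powr_add powr_diff)
        finally show ?thesis by (simp add: powr_realpow)
      qed
      have gen: "E2 * (K / B) / F * (P * P * X * E1 / (Q * G))
          = 1 / 2 * (E1 * E2) * (P / L) * (K * X * L * P / (B * Q / 2) / (F * G))"
        if "L > 0" "Q > 0" "G > 0" "F > 0" "B > 0" for E1 E2 K B F P X Q G L :: real
        using that by (simp add: field_simps)
      have "Gamma (real k + 2 * a + 1) > 0" using s s_eq by (intro Gamma_real_pos) linarith
      moreover have "l powr a > 0" "(2::real) powr (2 * a + 1 + real k) > 0" using l by auto
      ultimately show ?thesis
        unfolding c t p two poisson_weight_def power_divide by (intro gen) auto
    qed
    have "summable (\<lambda>k. c * t k)"
      using summable_chi_square_mixture[OF s, of l x] l by (simp add: trm)
    moreover have "c > 0" using x l by (simp add: c_def)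
    ultimately have "summable t" by (simp add: summable_cmult_iff)
    hence "(\<lambda>k. c * t k) sums (c * suminf t)" by (intro sums_mult summable_sums)
    moreover have "c * suminf t = noncentral_chi_square_density s l x"
      using x l by (simp add: noncentral_chi_square_density_def bessel_I_def c_def t_def)
    ultimately show ?thesis by (simp add: trm)
  qed
qed

lemma noncentral_chi_square_density_nonneg:
  assumes "s > 0" "l \<ge> 0"
  shows "0 \<le> noncentral_chi_square_density s l x"
  using noncentral_chi_square_sums[OF assms, of x]
  by (rule sums_le[OF _ sums_zero, rotated])
     (use assms in \<open>auto intro!: mult_nonneg_nonneg poisson_weight_nonneg chi_square_density_nonneg\<close>)

text \<open>
  Multiplication by \<open>x\<close> gives the \<open>k\<close>-th summand the factor \<open>s + 2 k\<close> and two more degrees of freedom. The part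
  \<open>2 k\<close> shifts the Poisson index by one, which accounts for the second term with four more degrees.
\<close>

lemma noncentral_chi_square_times:
  assumes s: "s > 0" and l: "l \<ge> 0"
  shows "x * noncentral_chi_square_density s l x
       = s * noncentral_chi_square_density (s + 2) l x + l * noncentral_chi_square_density (s + 4) l x"
proof -
  let ?w = "poisson_weight l" and ?p = chi_square_density
  have 1: "(\<lambda>k. s * (?w k * ?p (s + 2 + 2 * real k) x)) sums (s * noncentral_chi_square_density (s + 2) l x)"
    using s l by (intro sums_mult noncentral_chi_square_sums) auto
  have "(\<lambda>k. l * (?w k * ?p (s + 4 + 2 * real k) x)) sums (l * noncentral_chi_square_density (s + 4) l x)"
    using s l by (intro sums_mult noncentral_chi_square_sums) auto
  also have "(\<lambda>k. l * (?w k * ?p (s + 4 + 2 * real k) x))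
      = (\<lambda>k. 2 * real (Suc k) * ?w (Suc k) * ?p (s + 2 + 2 * real (Suc k)) x)"
    unfolding poisson_weight_Suc by (simp add: mult_ac add_ac)
  finally have 2: "(\<lambda>k. 2 * real k * ?w k * ?p (s + 2 + 2 * real k) x) sums (l * noncentral_chi_square_density (s + 4) l x)"
    by (subst (asm) sums_Suc_iff) simp
  have "x * (?w k * ?p (s + 2 * real k) x)
      = s * (?w k * ?p (s + 2 + 2 * real k) x) + 2 * real k * ?w k * ?p (s + 2 + 2 * real k) x" for k
  proof -
    have "x * ?p (s + 2 * real k) x = (s + 2 * real k) * ?p (s + 2 + 2 * real k) x"
      using chi_square_density_times[of "s + 2 * real k" x] s by (simp add: add_ac)
    hence "?w k * (x * ?p (s + 2 * real k) x) = ?w k * ((s + 2 * real k) * ?p (s + 2 + 2 * real k) x)"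
      by simp
    thus ?thesis by (simp only: distrib_right distrib_left mult_ac)
  qed
  moreover have "(\<lambda>k. x * (?w k * ?p (s + 2 * real k) x)) sums (x * noncentral_chi_square_density s l x)"
    using s l by (intro sums_mult noncentral_chi_square_sums)
  ultimately show ?thesis using sums_add[OF 1 2] by (simp add: sums_unique2)
qed

text \<open>
  Integration term by term: the \<open>k\<close>-th term has \<open>L\<^sup>1\<close> norm at most \<open>C\<close> times the \<open>k\<close>-th Poisson weight, and these
  weights are summable.
\<close>

lemma
  fixes g :: "real \<Rightarrow> real"
  assumes s: "s > 0" and l: "l \<ge> 0"
    and [measurable]: "g \<in> borel_measurable borel" and g: "\<And>x. \<bar>g x\<bar> \<le> C"
  shows integrable_noncentral_chi_square_mult:
      "integrable lborel (\<lambda>x. noncentral_chi_square_density s l x * g x)"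
    and noncentral_chi_square_integral_sums:
      "(\<lambda>k. poisson_weight l k * (LBINT x. chi_square_density (s + 2 * real k) x * g x))
         sums (LBINT x. noncentral_chi_square_density s l x * g x)"
proof -
  let ?w = "poisson_weight l" and ?p = chi_square_density
  define f where "f = (\<lambda>k x. ?w k * (?p (s + 2 * real k) x * g x))"
  have s': "s + 2 * real k > 0" for k using s by simp
  have int: "integrable lborel (\<lambda>x. ?p (s + 2 * real k) x * g x)" for k
    by (rule integrable_chi_square_mult[OF s' _ g]) simp
  have ptw: "(\<lambda>k. f k x) sums (noncentral_chi_square_density s l x * g x)" for x
    using sums_mult2[OF noncentral_chi_square_sums[OF s l, of x], of "g x"] by (simp add: f_def mult_ac)
  have "summable (\<lambda>k. norm (f k x))" for x
    using summable_mult2[OF summable_chi_square_mixture[OF s l, of x], of "\<bar>g x\<bar>"]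
      poisson_weight_nonneg[OF l] chi_square_density_nonneg[OF s']
    by (simp add: f_def abs_mult mult_ac)
  hence 1: "AE x in lborel. summable (\<lambda>k. norm (f k x))" by simp
  have 2: "summable (\<lambda>k. LBINT x. norm (f k x))"
  proof (rule summable_comparison_test')
    show "summable (\<lambda>k. C * (?w k * 1 ^ k))" by (intro summable_mult summable_poisson_weight_power)
    fix k :: nat
    have "(LBINT x. norm (f k x)) \<le> (LBINT x. C * ?w k * ?p (s + 2 * real k) x)"
    proof (rule integral_mono)
      show "integrable lborel (\<lambda>x. norm (f k x))" unfolding f_def using int by (intro integrable_norm) simp
      show "integrable lborel (\<lambda>x. C * ?w k * ?p (s + 2 * real k) x)"
        using has_bochner_integral_chi_square_density[OF s'] by (auto simp: has_bochner_integral_iff)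
      fix x
      have "?w k * ?p (s + 2 * real k) x * \<bar>g x\<bar> \<le> ?w k * ?p (s + 2 * real k) x * C"
        using poisson_weight_nonneg[OF l] chi_square_density_nonneg[OF s'] g by (intro mult_left_mono) auto
      thus "norm (f k x) \<le> C * ?w k * ?p (s + 2 * real k) x"
        using poisson_weight_nonneg[OF l, of k] chi_square_density_nonneg[OF s', of k x]
        by (simp add: f_def abs_mult mult_ac)
    qed
    also have "\<dots> = C * (?w k * 1 ^ k)"
      using has_bochner_integral_chi_square_density[OF s'] by (simp add: has_bochner_integral_iff)
    finally show "norm (LBINT x. norm (f k x)) \<le> C * (?w k * 1 ^ k)" by simp
  qed
  have int': "integrable lborel (f k)" for k unfolding f_def using int by simp
  have S: "(\<Sum>k. f k x) = noncentral_chi_square_density s l x * g x" for x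
    using sums_unique[OF ptw] by simp
  show "integrable lborel (\<lambda>x. noncentral_chi_square_density s l x * g x)"
    using integrable_suminf[OF int' 1 2] by (simp add: S)
  have "(\<lambda>k. integral\<^sup>L lborel (f k)) sums (LBINT x. noncentral_chi_square_density s l x * g x)"
    using sums_integral[OF int' 1 2] by (simp add: S)
  thus "(\<lambda>k. ?w k * (LBINT x. ?p (s + 2 * real k) x * g x))
         sums (LBINT x. noncentral_chi_square_density s l x * g x)"
    unfolding f_def using int by simp
qed

text \<open>
  The central shift identity applies to every component of the mixture, and the weights do not depend on
  the degrees of freedom.
\<close>

lemma noncentral_chi_square_shift:
  fixes g g' :: "real \<Rightarrow> real"
  assumes s: "s > 0" and l: "l \<ge> 0"
    and g: "\<And>x. (g has_real_derivative g' x) (at x)" and g': "continuous_on UNIV g'"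
    and bg: "\<And>x. \<bar>g x\<bar> \<le> C" and bg': "\<And>x. \<bar>g' x\<bar> \<le> C"
  shows "(LBINT x. noncentral_chi_square_density (s + 2) l x * (g x - 2 * g' x))
       = (LBINT x. noncentral_chi_square_density s l x * g x)"
proof -
  have cg: "continuous_on UNIV g"
    using g by (meson DERIV_isCont continuous_at_imp_continuous_on)
  have [measurable]: "g \<in> borel_measurable borel" "g' \<in> borel_measurable borel"
    using cg g' by (auto intro: borel_measurable_continuous_onI)
  have bd: "\<bar>g x - 2 * g' x\<bar> \<le> 3 * C" for x using bg[of x] bg'[of x] by linarith
  have "(LBINT x. chi_square_density (s + 2 + 2 * real k) x * (g x - 2 * g' x))
      = (LBINT x. chi_square_density (s + 2 * real k) x * g x)" for k
    using chi_square_shift[of "s + 2 * real k", OF _ g g' bg bg'] s by (simp add: add_ac)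
  moreover have "(\<lambda>k. poisson_weight l k * (LBINT x. chi_square_density (s + 2 + 2 * real k) x * (g x - 2 * g' x)))
      sums (LBINT x. noncentral_chi_square_density (s + 2) l x * (g x - 2 * g' x))"
    using s l bd by (intro noncentral_chi_square_integral_sums[where C = "3 * C"]) auto
  moreover have "(\<lambda>k. poisson_weight l k * (LBINT x. chi_square_density (s + 2 * real k) x * g x))
      sums (LBINT x. noncentral_chi_square_density s l x * g x)"
    using s l bg by (intro noncentral_chi_square_integral_sums[where C = C]) auto
  ultimately show ?thesis by (simp add: sums_unique2)
qed

section \<open>Functions with their derivatives\<close>

text \<open>
  A function is handled together with its derivatives as a sequence \<open>F\<close>, where \<open>F j\<close> is the \<open>j\<close>-th derivative of
  \<open>F 0\<close>. Linear combinations, affine substitutions and products then act on sequences by explicit formulas,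
  and iterated \<open>deriv\<close> enters only when the test class does.
\<close>

definition derivs :: "nat \<Rightarrow> (nat \<Rightarrow> real \<Rightarrow> real) \<Rightarrow> bool" where
  "derivs m F \<longleftrightarrow> (\<forall>j<m. \<forall>x. (F j has_real_derivative F (Suc j) x) (at x))
                 \<and> continuous_on UNIV (F m)"

definition bounded_derivs :: "nat \<Rightarrow> (nat \<Rightarrow> real \<Rightarrow> real) \<Rightarrow> bool" where
  "bounded_derivs m F \<longleftrightarrow> derivs m F \<and> (\<forall>j\<le>m. bounded (range (F j)))"

lemma derivs_has_derivative:
  "derivs m F \<Longrightarrow> j < m \<Longrightarrow> (F j has_real_derivative F (Suc j) x) (at x)"
  by (auto simp: derivs_def)

lemma derivs_continuous:
  assumes "derivs m F" "j \<le> m" shows "continuous_on UNIV (F j)"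
proof (cases "j = m")
  case False
  hence "j < m" using assms by simp
  thus ?thesis using derivs_has_derivative[OF assms(1)]
    by (meson DERIV_isCont continuous_at_imp_continuous_on)
qed (use assms in \<open>auto simp: derivs_def\<close>)

lemma derivs_measurable:
  "derivs m F \<Longrightarrow> j \<le> m \<Longrightarrow> F j \<in> borel_measurable borel"
  by (intro borel_measurable_continuous_onI derivs_continuous)

lemma bounded_derivsD: "bounded_derivs m F \<Longrightarrow> derivs m F"
  by (simp add: bounded_derivs_def)

lemma bounded_derivs_bound:
  assumes "bounded_derivs m F"
  obtains C where "\<And>j x. j \<le> m \<Longrightarrow> \<bar>F j x\<bar> \<le> C"
proof -
  have "bounded (\<Union>j\<le>m. range (F j))" using assms by (auto simp: bounded_derivs_def)
  then obtain C where "\<forall>y\<in>(\<Union>j\<le>m. range (F j)). norm y \<le> C" by (auto simp: bounded_iff)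
  thus ?thesis by (intro that[of C]) auto
qed

text \<open>
  Applying a differential operator with constant coefficients of order \<open>k\<close>, such as \<open>S\<close>, \<open>S'\<close> and their squares,
  costs \<open>k\<close> derivatives.
\<close>

lemma bounded_derivs_comb:
  assumes F: "bounded_derivs (m + k) F"
  shows "bounded_derivs m (\<lambda>j x. \<Sum>i\<le>k. c i * F (j + i) x)"
  unfolding bounded_derivs_def derivs_def
proof (intro conjI allI impI)
  fix j x assume "j < m"
  hence "(F (j + i) has_real_derivative F (Suc j + i) x) (at x)" if "i \<le> k" for i
    using derivs_has_derivative[OF bounded_derivsD[OF F], of "j + i"] that by simp
  thus "((\<lambda>x. \<Sum>i\<le>k. c i * F (j + i) x) has_real_derivative (\<Sum>i\<le>k. c i * F (Suc j + i) x)) (at x)"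
    by (intro DERIV_sum DERIV_cmult) auto
next
  show "continuous_on UNIV (\<lambda>x. \<Sum>i\<le>k. c i * F (m + i) x)"
    using derivs_continuous[OF bounded_derivsD[OF F]] by (intro continuous_intros) auto
next
  fix j assume j: "j \<le> m"
  obtain C where C: "\<And>j x. j \<le> m + k \<Longrightarrow> \<bar>F j x\<bar> \<le> C" using bounded_derivs_bound[OF F] by blast
  have "\<bar>\<Sum>i\<le>k. c i * F (j + i) x\<bar> \<le> (\<Sum>i\<le>k. \<bar>c i\<bar> * C)" for x
    using j by (intro order.trans[OF sum_abs] sum_mono) (auto simp: abs_mult intro!: mult_left_mono C)
  thus "bounded (range (\<lambda>x. \<Sum>i\<le>k. c i * F (j + i) x))" by (auto simp: bounded_iff)
qed

lemma derivs_affine: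
  assumes F: "derivs m F"
  shows "derivs m (\<lambda>j x. c ^ j * F j (c * x + a))"
  unfolding derivs_def
proof (intro conjI allI impI)
  fix j x assume "j < m"
  from derivs_has_derivative[OF F this, of "c * x + a"]
  have "((\<lambda>x. F j (c * x + a)) has_real_derivative c * F (Suc j) (c * x + a)) (at x)"
    by (rule DERIV_cong[OF DERIV_chain2[where g = "\<lambda>x. c * x + a" and x = x]])
       (auto intro!: derivative_eq_intros)
  from DERIV_cmult[OF this, of "c ^ j"]
  show "((\<lambda>x. c ^ j * F j (c * x + a)) has_real_derivative c ^ Suc j * F (Suc j) (c * x + a)) (at x)"
    by (simp add: mult_ac)
next
  show "continuous_on UNIV (\<lambda>x. c ^ m * F m (c * x + a))"
    by (intro continuous_intros continuous_on_compose2[OF derivs_continuous[OF F]]) auto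
qed

lemma bounded_derivs_affine:
  assumes F: "bounded_derivs m F"
  shows "bounded_derivs m (\<lambda>j x. c ^ j * F j (c * x + a))"
proof -
  have "bounded (range (\<lambda>x. c ^ j * F j (c * x + a)))" if j: "j \<le> m" for j
  proof -
    obtain C where C: "\<And>j x. j \<le> m \<Longrightarrow> \<bar>F j x\<bar> \<le> C" using bounded_derivs_bound[OF F] by blast
    have "\<bar>c ^ j * F j (c * x + a)\<bar> \<le> \<bar>c ^ j\<bar> * C" for x
      using C[OF j] by (auto simp: abs_mult intro!: mult_left_mono)
    thus ?thesis by (auto simp: bounded_iff)
  qed
  thus ?thesis using derivs_affine[OF bounded_derivsD[OF F]] by (simp add: bounded_derivs_def)
qed

corollary bounded_derivs_translate: "bounded_derivs m F \<Longrightarrow> bounded_derivs m (\<lambda>j x. F j (x - a))"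
  using bounded_derivs_affine[of m F 1 "- a"] by simp

corollary bounded_derivs_reflect: "bounded_derivs m F \<Longrightarrow> bounded_derivs m (\<lambda>j x. (-1) ^ j * F j (- x))"
  using bounded_derivs_affine[of m F "-1" 0] by simp

section \<open>Stein identities for the noncentral chi-square law\<close>

lemma
  fixes g :: "real \<Rightarrow> real"
  assumes s: "s > 0" and l: "l \<ge> 0"
    and [measurable]: "g \<in> borel_measurable borel" and g: "\<And>x. \<bar>g x\<bar> \<le> C"
  shows integrable_noncentral_chi_square_times:
      "integrable lborel (\<lambda>x. noncentral_chi_square_density s l x * (x * g x))"
    and noncentral_chi_square_integral_times:
      "(LBINT x. noncentral_chi_square_density s l x * (x * g x))
        = s * (LBINT x. noncentral_chi_square_density (s + 2) l x * g x)
          + l * (LBINT x. noncentral_chi_square_density (s + 4) l x * g x)"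
proof -
  let ?q = noncentral_chi_square_density
  have eq: "?q s l x * (x * g x) = s * (?q (s + 2) l x * g x) + l * (?q (s + 4) l x * g x)" for x
    using arg_cong[OF noncentral_chi_square_times[OF s l, of x], of "\<lambda>u. u * g x"]
    by (simp add: algebra_simps)
  have i: "integrable lborel (\<lambda>x. ?q (s + 2) l x * g x)" "integrable lborel (\<lambda>x. ?q (s + 4) l x * g x)"
    using s l g by (auto intro!: integrable_noncentral_chi_square_mult[where C = C])
  show "integrable lborel (\<lambda>x. ?q s l x * (x * g x))" unfolding eq using i by auto
  show "(LBINT x. ?q s l x * (x * g x))
        = s * (LBINT x. ?q (s + 2) l x * g x) + l * (LBINT x. ?q (s + 4) l x * g x)"
    unfolding eq using i by simp
qed

text \<open>
  With \<open>G = S F\<close> and \<open>S\<^sup>2 F = S G\<close>, multiplication by \<open>x\<close> leads to \<open>r + 2\<close> and \<open>r + 4\<close> degrees of freedom. One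
  application of \<open>S\<close> brings \<open>r + 2\<close> back to \<open>r\<close>, and two applications bring \<open>r + 4\<close> back to \<open>r\<close>.
\<close>

lemma noncentral_chi_square_stein_integral:
  assumes r: "r > 0" and l: "l \<ge> 0" and F: "bounded_derivs 2 F"
  shows "(LBINT x. noncentral_chi_square_density r l x * (x * (F 0 x - 4 * F 1 x + 4 * F 2 x)))
       = (LBINT x. noncentral_chi_square_density r l x * ((r + l) * F 0 x - 2 * r * F 1 x))"
proof -
  let ?q = noncentral_chi_square_density
  obtain C where C: "\<And>j x. j \<le> 2 \<Longrightarrow> \<bar>F j x\<bar> \<le> C" using bounded_derivs_bound[OF F] by blast
  note D = derivs_has_derivative[OF bounded_derivsD[OF F]]
  have c: "continuous_on UNIV (F 0)" "continuous_on UNIV (F 1)" "continuous_on UNIV (F 2)"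
    using derivs_continuous[OF bounded_derivsD[OF F]] by auto
  have [measurable]: "F 0 \<in> borel_measurable borel" "F 1 \<in> borel_measurable borel" "F 2 \<in> borel_measurable borel"
    using c by (auto intro: borel_measurable_continuous_onI)
  define G where "G = (\<lambda>x. F 0 x - 2 * F 1 x)"
  define G' where "G' = (\<lambda>x. F 1 x - 2 * F 2 x)"
  have bounds: "\<bar>F 0 x\<bar> \<le> C" "\<bar>F 1 x\<bar> \<le> C" "\<bar>F 2 x\<bar> \<le> C" for x using C by auto
  have GC: "\<bar>G x\<bar> \<le> 3 * C" "\<bar>G' x\<bar> \<le> 3 * C" for x
    using bounds[of x] unfolding G_def G'_def by linarith+
  have GC': "\<bar>G x - 2 * G' x\<bar> \<le> 9 * C" for x
    using GC[of x] by linarith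
  have [measurable]: "G \<in> borel_measurable borel" "G' \<in> borel_measurable borel" unfolding G_def G'_def
    by (auto simp del: One_nat_def)
  have dF: "(F 0 has_real_derivative F 1 x) (at x)" "(F 1 has_real_derivative F 2 x) (at x)" for x
    using D[of 0] D[of 1] by (auto simp: numeral_2_eq_2)
  have dG: "(G has_real_derivative G' x) (at x)" for x
    unfolding G_def G'_def by (rule derivative_eq_intros dF refl)+ simp
  have cG': "continuous_on UNIV G'" unfolding G'_def using c by (intro continuous_intros) auto
  have iG: "integrable lborel (\<lambda>x. ?q r l x * G x)" and iF: "integrable lborel (\<lambda>x. ?q r l x * F 0 x)"
    using integrable_noncentral_chi_square_mult[OF r l _ GC(1)]
      integrable_noncentral_chi_square_mult[OF r l _ bounds(1)] by auto
  have "(LBINT x. ?q r l x * (x * (F 0 x - 4 * F 1 x + 4 * F 2 x)))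
      = (LBINT x. ?q r l x * (x * (G x - 2 * G' x)))"
    by (rule Bochner_Integration.integral_cong) (auto simp: G_def G'_def algebra_simps)
  also have "\<dots> = r * (LBINT x. ?q (r + 2) l x * (G x - 2 * G' x)) + l * (LBINT x. ?q (r + 4) l x * (G x - 2 * G' x))"
    using r l GC' by (intro noncentral_chi_square_integral_times[where C = "9 * C"]) auto
  also have "(LBINT x. ?q (r + 2) l x * (G x - 2 * G' x)) = (LBINT x. ?q r l x * G x)"
    by (rule noncentral_chi_square_shift[OF r l dG cG' GC(1,2)])
  also have "(LBINT x. ?q (r + 4) l x * (G x - 2 * G' x)) = (LBINT x. ?q (r + 2) l x * G x)"
    using noncentral_chi_square_shift[OF _ l dG cG' GC(1,2), of "r + 2"] r by (simp add: add_ac)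
  also have "\<dots> = (LBINT x. ?q r l x * F 0 x)"
    unfolding G_def by (rule noncentral_chi_square_shift[OF r l dF(1) c(2) bounds(1,2)])
  also have "r * (LBINT x. ?q r l x * G x) + l * (LBINT x. ?q r l x * F 0 x)
      = (LBINT x. r * (?q r l x * G x) + l * (?q r l x * F 0 x))"
    using iG iF by simp
  also have "\<dots> = (LBINT x. ?q r l x * ((r + l) * F 0 x - 2 * r * F 1 x))"
    by (rule Bochner_Integration.integral_cong) (auto simp: G_def algebra_simps)
  finally show ?thesis .
qed

text \<open>
  Without noncentrality the term with \<open>r + 4\<close> degrees of freedom is absent, and a single \<open>S\<close> suffices.
\<close>

lemma central_chi_square_stein_integral:
  assumes r: "r > 0" and F: "bounded_derivs 1 F"
  shows "(LBINT x. noncentral_chi_square_density r 0 x * (x * (F 0 x - 2 * F 1 x)))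
       = (LBINT x. noncentral_chi_square_density r 0 x * (r * F 0 x))"
proof -
  let ?q = noncentral_chi_square_density
  obtain C where C: "\<And>j x. j \<le> 1 \<Longrightarrow> \<bar>F j x\<bar> \<le> C" using bounded_derivs_bound[OF F] by blast
  have c: "continuous_on UNIV (F 0)" "continuous_on UNIV (F 1)"
    using derivs_continuous[OF bounded_derivsD[OF F]] by auto
  have [measurable]: "F 0 \<in> borel_measurable borel" "F 1 \<in> borel_measurable borel"
    using c by (auto intro: borel_measurable_continuous_onI)
  have b: "\<bar>F 0 x\<bar> \<le> C" "\<bar>F 1 x\<bar> \<le> C" "\<bar>F 0 x - 2 * F 1 x\<bar> \<le> 3 * C" for x
    using C[of 0 x] C[of 1 x] by linarith+
  have dF: "(F 0 has_real_derivative F 1 x) (at x)" for x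
    using derivs_has_derivative[OF bounded_derivsD[OF F], of 0] by simp
  have "(LBINT x. ?q r 0 x * (x * (F 0 x - 2 * F 1 x))) = r * (LBINT x. ?q (r + 2) 0 x * (F 0 x - 2 * F 1 x))"
    by (subst noncentral_chi_square_integral_times[where C = "3 * C"]) (use r b in \<open>auto simp del: One_nat_def\<close>)
  also have "(LBINT x. ?q (r + 2) 0 x * (F 0 x - 2 * F 1 x)) = (LBINT x. ?q r 0 x * F 0 x)"
    by (rule noncentral_chi_square_shift[OF r _ dF c(2) b(1,2)]) simp
  also have "r * (LBINT x. ?q r 0 x * F 0 x) = (LBINT x. r * (?q r 0 x * F 0 x))"
    by simp
  finally show ?thesis by (simp add: mult_ac)
qed

section \<open>Differences of independent chi-square variables\<close>

lemma (in prob_space) indep_var_swap: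
  assumes "indep_var S X T Y"
  shows "indep_var T Y S X"
proof -
  have [measurable]: "random_variable S X" "random_variable T Y"
    and eq: "distr M S X \<Otimes>\<^sub>M distr M T Y = distr M (S \<Otimes>\<^sub>M T) (\<lambda>\<omega>. (X \<omega>, Y \<omega>))"
    using assms by (auto simp: indep_var_distribution_eq)
  interpret X: prob_space "distr M S X" by (rule prob_space_distr) simp
  interpret Y: prob_space "distr M T Y" by (rule prob_space_distr) simp
  interpret P: pair_sigma_finite "distr M T Y" "distr M S X" ..
  have "distr M T Y \<Otimes>\<^sub>M distr M S X
      = distr (distr M S X \<Otimes>\<^sub>M distr M T Y) (distr M T Y \<Otimes>\<^sub>M distr M S X) (\<lambda>(x, y). (y, x))"
    by (rule P.distr_pair_swap)
  also have "\<dots> = distr (distr M (S \<Otimes>\<^sub>M T) (\<lambda>\<omega>. (X \<omega>, Y \<omega>))) (T \<Otimes>\<^sub>M S) (\<lambda>(x, y). (y, x))"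
    unfolding eq by (intro distr_cong refl sets_pair_measure_cong) simp_all
  also have "\<dots> = distr M (T \<Otimes>\<^sub>M S) (\<lambda>\<omega>. (Y \<omega>, X \<omega>))"
    by (subst distr_distr) (auto simp: comp_def intro!: measurable_Pair)
  finally show ?thesis by (simp add: indep_var_distribution_eq)
qed

text \<open>
  Fubini in the form in which a one-variable identity with a free parameter \<open>y\<close> is transferred to an
  independent random parameter.
\<close>

lemma (in prob_space) indep_var_expectation_zero:
  fixes X Y :: "'a \<Rightarrow> real" and h :: "real \<Rightarrow> real \<Rightarrow> real"
  assumes indep: "indep_var borel X borel Y"
    and h [measurable]: "case_prod h \<in> borel_measurable (borel \<Otimes>\<^sub>M borel)"
    and int: "integrable M (\<lambda>\<omega>. h (X \<omega>) (Y \<omega>))"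
    and zero: "\<And>y. expectation (\<lambda>\<omega>. h (X \<omega>) y) = 0"
  shows "expectation (\<lambda>\<omega>. h (X \<omega>) (Y \<omega>)) = 0"
proof -
  have [measurable]: "random_variable borel X" "random_variable borel Y"
    and eq: "distr M borel X \<Otimes>\<^sub>M distr M borel Y = distr M (borel \<Otimes>\<^sub>M borel) (\<lambda>\<omega>. (X \<omega>, Y \<omega>))"
    using indep by (auto simp: indep_var_distribution_eq)
  interpret X: prob_space "distr M borel X" by (rule prob_space_distr) simp
  interpret Y: prob_space "distr M borel Y" by (rule prob_space_distr) simp
  interpret P: pair_sigma_finite "distr M borel X" "distr M borel Y" ..
  have int': "integrable (distr M borel X \<Otimes>\<^sub>M distr M borel Y) (case_prod h)"
    unfolding eq using int by (subst integrable_distr_eq) auto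
  have "expectation (\<lambda>\<omega>. h (X \<omega>) (Y \<omega>)) = integral\<^sup>L (distr M borel X \<Otimes>\<^sub>M distr M borel Y) (case_prod h)"
    unfolding eq by (subst integral_distr) auto
  also have "\<dots> = (\<integral>y. (\<integral>x. h x y \<partial>distr M borel X) \<partial>distr M borel Y)"
    using P.integral_snd[OF int'] by simp
  also have "(\<lambda>y. \<integral>x. h x y \<partial>distr M borel X) = (\<lambda>y. 0)"
    using zero by (subst integral_distr) auto
  finally show ?thesis by simp
qed

lemma
  fixes g :: "real \<Rightarrow> real"
  assumes V: "distributed M lborel V (\<lambda>x. ennreal (noncentral_chi_square_density r l x))"
    and r: "r > 0" and l: "l \<ge> 0" and g: "g \<in> borel_measurable borel"
  shows noncentral_chi_square_expectation:
      "(\<integral>\<omega>. g (V \<omega>) \<partial>M) = (LBINT x. noncentral_chi_square_density r l x * g x)"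
    and noncentral_chi_square_integrable_iff:
      "integrable M (\<lambda>\<omega>. g (V \<omega>)) \<longleftrightarrow> integrable lborel (\<lambda>x. noncentral_chi_square_density r l x * g x)"
  using distributed_integral[OF V, of g] distributed_integrable[OF V, of g] g
    noncentral_chi_square_density_nonneg[OF r l] by auto

lemma noncentral_chi_square_integrable:
  assumes "distributed M lborel V (\<lambda>x. ennreal (noncentral_chi_square_density r l x))"
    and "r > 0" and "l \<ge> 0"
  shows "integrable M V"
  using noncentral_chi_square_integrable_iff[OF assms, of "\<lambda>x. x"]
    integrable_noncentral_chi_square_times[OF assms(2,3), of "\<lambda>_. 1" 1] by simp

lemma (in prob_space) integrable_times_bounded_derivs:
  assumes V: "integrable M V" and T [measurable]: "random_variable borel T"
    and F: "bounded_derivs m F" and j: "j \<le> m"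
  shows "integrable M (\<lambda>\<omega>. F j (T \<omega>))" "integrable M (\<lambda>\<omega>. V \<omega> * F j (T \<omega>))"
proof -
  obtain C where C: "\<And>j x. j \<le> m \<Longrightarrow> \<bar>F j x\<bar> \<le> C" using bounded_derivs_bound[OF F] by blast
  note [measurable] = derivs_measurable[OF bounded_derivsD[OF F] j] borel_measurable_integrable[OF V]
  show "integrable M (\<lambda>\<omega>. F j (T \<omega>))"
    using C[OF j] by (intro integrable_const_bound[where B = C]) auto
  show "integrable M (\<lambda>\<omega>. V \<omega> * F j (T \<omega>))"
  proof (rule Bochner_Integration.integrable_bound)
    show "integrable M (\<lambda>\<omega>. C * V \<omega>)" using V by simp
    show "AE \<omega> in M. norm (V \<omega> * F j (T \<omega>)) \<le> norm (C * V \<omega>)"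
    proof (rule AE_I2)
      fix \<omega>
      have "\<bar>F j (T \<omega>)\<bar> \<le> \<bar>C\<bar>" using C[OF j, of "T \<omega>"] by linarith
      thus "norm (V \<omega> * F j (T \<omega>)) \<le> norm (C * V \<omega>)"
        by (simp add: abs_mult mult.commute[of "\<bar>C\<bar>"] mult_left_mono)
    qed
  qed simp
qed

text \<open>
  For fixed \<open>y\<close> the translate \<open>x \<mapsto> F(x - y)\<close> again has bounded derivatives, so the one-variable identity
  applies to it.
\<close>

lemma (in prob_space) noncentral_chi_square_difference_stein:
  assumes V: "distributed M lborel V (\<lambda>x. ennreal (noncentral_chi_square_density r l x))"
    and r: "r > 0" and l: "l \<ge> 0"
    and indep: "indep_var borel V borel U" and F: "bounded_derivs 2 F"
  shows "has_bochner_integral M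
    (\<lambda>\<omega>. V \<omega> * (F 0 (V \<omega> - U \<omega>) - 4 * F 1 (V \<omega> - U \<omega>) + 4 * F 2 (V \<omega> - U \<omega>))
        - ((r + l) * F 0 (V \<omega> - U \<omega>) - 2 * r * F 1 (V \<omega> - U \<omega>))) 0"
proof -
  note iV = noncentral_chi_square_integrable[OF V r l]
  have [measurable]: "random_variable borel V" "random_variable borel U"
    using indep_var_rv1[OF indep] indep_var_rv2[OF indep] by auto
  note [measurable] = derivs_measurable[OF bounded_derivsD[OF F], of 0]
    derivs_measurable[OF bounded_derivsD[OF F], of 1] derivs_measurable[OF bounded_derivsD[OF F], of 2]
  define h where "h = (\<lambda>x y. x * (F 0 (x - y) - 4 * F 1 (x - y) + 4 * F 2 (x - y))
        - ((r + l) * F 0 (x - y) - 2 * r * F 1 (x - y)))"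
  have int: "integrable M (\<lambda>\<omega>. h (V \<omega>) (U \<omega>))" if [measurable]: "random_variable borel U" for U
  proof -
    have [measurable]: "random_variable borel (\<lambda>\<omega>. V \<omega> - U \<omega>)" by simp
    note i = integrable_times_bounded_derivs[OF iV this F]
    have eq: "h (V \<omega>) (U \<omega>) = V \<omega> * F 0 (V \<omega> - U \<omega>) - 4 * (V \<omega> * F 1 (V \<omega> - U \<omega>))
        + 4 * (V \<omega> * F 2 (V \<omega> - U \<omega>))
        - ((r + l) * F 0 (V \<omega> - U \<omega>) - 2 * r * F 1 (V \<omega> - U \<omega>))" for \<omega>
      unfolding h_def by (simp add: algebra_simps)
    show ?thesis unfolding eq
      by (intro Bochner_Integration.integrable_diff Bochner_Integration.integrable_add
          integrable_mult_right i) auto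
  qed
  have "expectation (\<lambda>\<omega>. h (V \<omega>) (U \<omega>)) = 0"
  proof (rule indep_var_expectation_zero[OF indep])
    show "case_prod h \<in> borel_measurable (borel \<Otimes>\<^sub>M borel)" unfolding h_def by measurable
    show "integrable M (\<lambda>\<omega>. h (V \<omega>) (U \<omega>))" by (rule int) simp
    fix y
    let ?G = "\<lambda>j x. F j (x - y)"
    note G = bounded_derivs_translate[OF F, of y]
    have "integrable M (\<lambda>\<omega>. V \<omega> * ?G j (V \<omega>))" "integrable M (\<lambda>\<omega>. ?G j (V \<omega>))" if "j \<le> 2" for j
      using integrable_times_bounded_derivs[OF iV _ G that] by auto
    hence "integrable M (\<lambda>\<omega>. V \<omega> * ?G 0 (V \<omega>) - 4 * (V \<omega> * ?G 1 (V \<omega>)) + 4 * (V \<omega> * ?G 2 (V \<omega>)))"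
      "integrable M (\<lambda>\<omega>. (r + l) * ?G 0 (V \<omega>) - 2 * r * ?G 1 (V \<omega>))"
      by (intro Bochner_Integration.integrable_diff Bochner_Integration.integrable_add
          integrable_mult_right; simp)+
    moreover have "V \<omega> * ?G 0 (V \<omega>) - 4 * (V \<omega> * ?G 1 (V \<omega>)) + 4 * (V \<omega> * ?G 2 (V \<omega>))
        = V \<omega> * (?G 0 (V \<omega>) - 4 * ?G 1 (V \<omega>) + 4 * ?G 2 (V \<omega>))" for \<omega> by (simp add: algebra_simps)
    ultimately have "expectation (\<lambda>\<omega>. h (V \<omega>) y)
        = expectation (\<lambda>\<omega>. V \<omega> * (?G 0 (V \<omega>) - 4 * ?G 1 (V \<omega>) + 4 * ?G 2 (V \<omega>)))
          - expectation (\<lambda>\<omega>. (r + l) * ?G 0 (V \<omega>) - 2 * r * ?G 1 (V \<omega>))"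
      unfolding h_def by (subst Bochner_Integration.integral_diff[symmetric]) auto
    also have "\<dots> = 0"
      using noncentral_chi_square_stein_integral[OF r l G]
        noncentral_chi_square_expectation[OF V r l, of "\<lambda>x. x * (?G 0 x - 4 * ?G 1 x + 4 * ?G 2 x)"]
        noncentral_chi_square_expectation[OF V r l, of "\<lambda>x. (r + l) * ?G 0 x - 2 * r * ?G 1 x"]
      by (simp del: One_nat_def)
    finally show "expectation (\<lambda>\<omega>. h (V \<omega>) y) = 0" .
  qed
  thus ?thesis using int[of U] by (simp add: has_bochner_integral_iff h_def)
qed

lemma (in prob_space) central_chi_square_difference_stein:
  assumes V: "distributed M lborel V (\<lambda>x. ennreal (noncentral_chi_square_density r 0 x))"
    and r: "r > 0"
    and indep: "indep_var borel V borel U" and F: "bounded_derivs 1 F"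
  shows "has_bochner_integral M
    (\<lambda>\<omega>. V \<omega> * (F 0 (V \<omega> - U \<omega>) - 2 * F 1 (V \<omega> - U \<omega>)) - r * F 0 (V \<omega> - U \<omega>)) 0"
proof -
  note iV = noncentral_chi_square_integrable[OF V r order.refl]
  have [measurable]: "random_variable borel V" "random_variable borel U"
    using indep_var_rv1[OF indep] indep_var_rv2[OF indep] by auto
  note [measurable] = derivs_measurable[OF bounded_derivsD[OF F], of 0]
    derivs_measurable[OF bounded_derivsD[OF F], of 1]
  define h where "h = (\<lambda>x y. x * (F 0 (x - y) - 2 * F 1 (x - y)) - r * F 0 (x - y))"
  have int: "integrable M (\<lambda>\<omega>. h (V \<omega>) (U \<omega>))" if [measurable]: "random_variable borel U" for U
  proof -
    have [measurable]: "random_variable borel (\<lambda>\<omega>. V \<omega> - U \<omega>)" by simp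
    note i = integrable_times_bounded_derivs[OF iV this F]
    have eq: "h (V \<omega>) (U \<omega>) = V \<omega> * F 0 (V \<omega> - U \<omega>) - 2 * (V \<omega> * F 1 (V \<omega> - U \<omega>))
        - r * F 0 (V \<omega> - U \<omega>)" for \<omega>
      unfolding h_def by (simp add: algebra_simps)
    show ?thesis unfolding eq
      by (intro Bochner_Integration.integrable_diff integrable_mult_right i) auto
  qed
  have "expectation (\<lambda>\<omega>. h (V \<omega>) (U \<omega>)) = 0"
  proof (rule indep_var_expectation_zero[OF indep])
    show "case_prod h \<in> borel_measurable (borel \<Otimes>\<^sub>M borel)" unfolding h_def by measurable
    show "integrable M (\<lambda>\<omega>. h (V \<omega>) (U \<omega>))" by (rule int) simp
    fix y
    let ?G = "\<lambda>j x. F j (x - y)"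
    note G = bounded_derivs_translate[OF F, of y]
    have "integrable M (\<lambda>\<omega>. V \<omega> * ?G j (V \<omega>))" "integrable M (\<lambda>\<omega>. ?G j (V \<omega>))" if "j \<le> 1" for j
      using integrable_times_bounded_derivs[OF iV _ G that] by auto
    hence "integrable M (\<lambda>\<omega>. V \<omega> * ?G 0 (V \<omega>) - 2 * (V \<omega> * ?G 1 (V \<omega>)))"
      "integrable M (\<lambda>\<omega>. r * ?G 0 (V \<omega>))"
      by (intro Bochner_Integration.integrable_diff integrable_mult_right; simp)+
    moreover have "V \<omega> * ?G 0 (V \<omega>) - 2 * (V \<omega> * ?G 1 (V \<omega>))
        = V \<omega> * (?G 0 (V \<omega>) - 2 * ?G 1 (V \<omega>))" for \<omega> by (simp add: algebra_simps)
    ultimately have "expectation (\<lambda>\<omega>. h (V \<omega>) y)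
        = expectation (\<lambda>\<omega>. V \<omega> * (?G 0 (V \<omega>) - 2 * ?G 1 (V \<omega>)))
          - expectation (\<lambda>\<omega>. r * ?G 0 (V \<omega>))"
      unfolding h_def by (subst Bochner_Integration.integral_diff[symmetric]) auto
    also have "\<dots> = 0"
      using central_chi_square_stein_integral[OF r G]
        noncentral_chi_square_expectation[OF V r order.refl, of "\<lambda>x. x * (?G 0 x - 2 * ?G 1 x)"]
        noncentral_chi_square_expectation[OF V r order.refl, of "\<lambda>x. r * ?G 0 x"]
      by (simp del: One_nat_def)
    finally show "expectation (\<lambda>\<omega>. h (V \<omega>) y) = 0" .
  qed
  thus ?thesis using int[of U] by (simp add: has_bochner_integral_iff h_def)
qed

section \<open>Extending an identity by a cutoff\<close>

lemma derivs_deriv_iterate: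
  assumes F: "derivs m F" and "j \<le> m"
  shows "(deriv ^^ j) (F 0) = F j"
  using \<open>j \<le> m\<close>
proof (induction j)
  case (Suc j)
  hence "(deriv ^^ Suc j) (F 0) = deriv (F j)" by simp
  also have "\<dots> = F (Suc j)"
    using derivs_has_derivative[OF F, of j] Suc.prems by (intro ext DERIV_imp_deriv) simp
  finally show ?case .
qed simp

lemma C_diff_iff_derivs: "C_diff m f \<longleftrightarrow> derivs m (\<lambda>j. (deriv ^^ j) f)"
  unfolding C_diff_def derivs_def
  by (simp add: differentiable_on_def DERIV_deriv_iff_real_differentiable)

lemma derivs_imp_C_diff:
  assumes "derivs m F" shows "C_diff m (F 0)"
proof -
  have "derivs m (\<lambda>j. (deriv ^^ j) (F 0))"
    using assms derivs_deriv_iterate[OF assms] by (simp add: derivs_def Suc_le_eq del: funpow.simps)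
  thus ?thesis by (simp add: C_diff_iff_derivs)
qed

text \<open>
  The derivatives of a product, by the general Leibniz rule.
\<close>

definition leibniz :: "(nat \<Rightarrow> real \<Rightarrow> real) \<Rightarrow> (nat \<Rightarrow> real \<Rightarrow> real) \<Rightarrow> nat \<Rightarrow> real \<Rightarrow> real" where
  "leibniz F G j x = (\<Sum>i\<le>j. real (j choose i) * (F i x * G (j - i) x))"

text \<open>
  Pascal's rule splits the coefficients of the \<open>(j + 1)\<close>-st derivative into the two sums that arise by
  differentiating either factor of each term of the \<open>j\<close>-th.
\<close>

lemma leibniz_Suc:
  "leibniz F G (Suc j) x
     = (\<Sum>i\<le>j. real (j choose i) * (F (Suc i) x * G (j - i) x + F i x * G (Suc (j - i)) x))"
proof -
  have "leibniz F G (Suc j) x = F 0 x * G (Suc j) x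
      + (\<Sum>i\<le>j. real (Suc j choose Suc i) * (F (Suc i) x * G (j - i) x))"
    unfolding leibniz_def by (subst sum.atMost_Suc_shift) simp
  also have "(\<Sum>i\<le>j. real (Suc j choose Suc i) * (F (Suc i) x * G (j - i) x))
      = (\<Sum>i\<le>j. real (j choose i) * (F (Suc i) x * G (j - i) x))
        + (\<Sum>i\<le>j. real (j choose Suc i) * (F (Suc i) x * G (j - i) x))"
    by (simp add: sum.distrib[symmetric] algebra_simps)
  also have "F 0 x * G (Suc j) x
        + ((\<Sum>i\<le>j. real (j choose i) * (F (Suc i) x * G (j - i) x))
           + (\<Sum>i\<le>j. real (j choose Suc i) * (F (Suc i) x * G (j - i) x)))
      = (\<Sum>i\<le>j. real (j choose i) * (F (Suc i) x * G (j - i) x))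
        + (\<Sum>i\<le>Suc j. real (j choose i) * (F i x * G (Suc j - i) x))"
    by (subst sum.atMost_Suc_shift) simp
  also have "(\<Sum>i\<le>Suc j. real (j choose i) * (F i x * G (Suc j - i) x))
      = (\<Sum>i\<le>j. real (j choose i) * (F i x * G (Suc (j - i)) x))"
    by (simp add: Suc_diff_le)
  finally show ?thesis by (simp add: sum.distrib[symmetric] algebra_simps)
qed

lemma derivs_leibniz:
  assumes F: "derivs m F" and G: "derivs m G"
  shows "derivs m (leibniz F G)"
  unfolding derivs_def
proof (intro conjI allI impI)
  fix j x assume j: "j < m"
  have "((\<lambda>x. \<Sum>i\<le>j. real (j choose i) * (F i x * G (j - i) x)) has_real_derivative
      (\<Sum>i\<le>j. real (j choose i) * (F (Suc i) x * G (j - i) x + F i x * G (Suc (j - i)) x))) (at x)"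
  proof (intro DERIV_sum DERIV_cmult)
    fix i assume "i \<in> {..j}"
    hence "(F i has_real_derivative F (Suc i) x) (at x)"
      "(G (j - i) has_real_derivative G (Suc (j - i)) x) (at x)"
      using j by (auto intro!: derivs_has_derivative[OF F] derivs_has_derivative[OF G])
    from DERIV_mult[OF this]
    show "((\<lambda>x. F i x * G (j - i) x) has_real_derivative F (Suc i) x * G (j - i) x + F i x * G (Suc (j - i)) x) (at x)"
      by (simp add: mult_ac add_ac)
  qed
  thus "(leibniz F G j has_real_derivative leibniz F G (Suc j) x) (at x)"
    unfolding leibniz_Suc by (simp add: leibniz_def[abs_def])
next
  show "continuous_on UNIV (leibniz F G m)"
    unfolding leibniz_def[abs_def]
    by (intro continuous_intros derivs_continuous[OF F] derivs_continuous[OF G]) auto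
qed

text \<open>
  At \<open>0\<close> the exponent of at least two allows Caratheodory's criterion: the difference quotient is
  the continuous function \<open>max 0 z ^ (k + 1)\<close>.
\<close>

lemma has_derivative_pos_part_power:
  "((\<lambda>x::real. max 0 x ^ Suc (Suc k)) has_real_derivative real (Suc (Suc k)) * max 0 x ^ Suc k) (at x)"
proof -
  consider "x < 0" | "x = 0" | "x > 0" by linarith
  thus ?thesis
  proof cases
    assume x: "x < 0"
    have "((\<lambda>x::real. 0) has_real_derivative real (Suc (Suc k)) * max 0 x ^ Suc k) (at x)" using x by simp
    thus ?thesis
      by (rule has_field_derivative_transform_within_open[where S = "{..<0}"]) (use x in auto)
  next
    assume x: "x = 0"
    have "\<exists>g. (\<forall>z. max 0 z ^ Suc (Suc k) - max 0 (0::real) ^ Suc (Suc k) = g z * (z - 0)) \<and> isCont g 0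
            \<and> g 0 = real (Suc (Suc k)) * max 0 0 ^ Suc k"
    proof (intro exI[of _ "\<lambda>z. max 0 z ^ Suc k"] conjI allI)
      show "isCont (\<lambda>z::real. max 0 z ^ Suc k) 0" by (intro continuous_intros)
    qed (auto simp: max_def)
    thus ?thesis unfolding x by (simp only: CARAT_DERIV)
  next
    assume x: "x > 0"
    have "((\<lambda>x::real. x ^ Suc (Suc k)) has_real_derivative real (Suc (Suc k)) * max 0 x ^ Suc k) (at x)"
      by (rule DERIV_cong[OF DERIV_pow]) (use x in \<open>simp add: max_def\<close>)
    thus ?thesis
      by (rule has_field_derivative_transform_within_open[where S = "{0<..}"]) (use x in \<open>auto simp: max_def\<close>)
  qed
qed

lemma derivs_pos_part_power:
  "derivs m (\<lambda>j x. (\<Prod>i<j. real (m + 1 - i)) * max 0 x ^ (m + 1 - j))"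
  unfolding derivs_def
proof (intro conjI allI impI)
  fix j and x :: real assume "j < m"
  then obtain k where k: "m = Suc (j + k)" using less_iff_Suc_add by auto
  have e: "m + 1 - j = Suc (Suc k)" "m + 1 - Suc j = Suc k" using k by auto
  show "((\<lambda>x. (\<Prod>i<j. real (m + 1 - i)) * max 0 x ^ (m + 1 - j)) has_real_derivative
      (\<Prod>i<Suc j. real (m + 1 - i)) * max 0 x ^ (m + 1 - Suc j)) (at x)"
    unfolding prod.lessThan_Suc e mult.assoc
    by (rule DERIV_cmult[OF has_derivative_pos_part_power])
next
  show "continuous_on UNIV (\<lambda>x::real. (\<Prod>i<m. real (m + 1 - i)) * max 0 x ^ (m + 1 - m))"
    by (intro continuous_intros)
qed

text \<open>
  The cutoff is \<open>max 0 (1 + x) ^ (m + 1) * max 0 (1 - x) ^ (m + 1)\<close>. Derivatives of order at most \<open>m\<close> leave a positive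
  power of each factor, so every term of the Leibniz formula vanishes for \<open>\<bar>x\<bar> \<ge> 1\<close>.
\<close>

lemma derivs_cutoff:
  obtains \<eta> where "derivs m \<eta>" "\<And>j x. j \<le> m \<Longrightarrow> \<bar>x\<bar> \<ge> 1 \<Longrightarrow> \<eta> j x = 0" "\<eta> 0 0 = 1"
proof -
  define P where "P = (\<lambda>j x. (\<Prod>i<j. real (m + 1 - i)) * max 0 x ^ (m + 1 - j))"
  have P: "derivs m P" unfolding P_def by (rule derivs_pos_part_power)
  have P0: "P j x = 0" if "j \<le> m" "x \<le> 0" for j x
    using that by (auto simp: P_def max_def)
  let ?L = "\<lambda>j x. 1 ^ j * P j (1 * x + 1)" and ?R = "\<lambda>j x. (-1) ^ j * P j (-1 * x + 1)"
  show ?thesis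
  proof (rule that[of "leibniz ?L ?R"])
    show "derivs m (leibniz ?L ?R)" by (intro derivs_leibniz derivs_affine P)
    show "leibniz ?L ?R j x = 0" if "j \<le> m" "\<bar>x\<bar> \<ge> 1" for j x
    proof -
      have "P i (1 * x + 1) = 0 \<or> P (j - i) (-1 * x + 1) = 0" if "i \<le> j" for i
        using P0[of i "1 * x + 1"] P0[of "j - i" "-1 * x + 1"] \<open>j \<le> m\<close> \<open>\<bar>x\<bar> \<ge> 1\<close> that by linarith
      thus ?thesis unfolding leibniz_def by (intro sum.neutral) auto
    qed
    show "leibniz ?L ?R 0 0 = 1" by (simp add: leibniz_def P_def)
  qed
qed

lemma bounded_derivs_compact_support:
  assumes F: "derivs m F" and supp: "\<And>j x. j \<le> m \<Longrightarrow> \<bar>x\<bar> \<ge> R \<Longrightarrow> F j x = 0"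
  shows "bounded_derivs m F"
proof -
  have "bounded (range (F j))" if j: "j \<le> m" for j
  proof -
    have "compact (F j ` {-R..R})"
      using derivs_continuous[OF F j] by (intro compact_continuous_image) (auto intro: continuous_on_subset)
    hence "bounded (insert 0 (F j ` {-R..R}))" by (simp add: compact_imp_bounded)
    moreover have "F j x \<in> insert 0 (F j ` {-R..R})" for x
      using supp[OF j, of x] by (cases "\<bar>x\<bar> \<ge> R") (auto simp: abs_le_iff intro!: imageI)
    ultimately show ?thesis by (meson bounded_subset image_subsetI)
  qed
  thus ?thesis using F by (simp add: bounded_derivs_def)
qed

text \<open>
  The common form of all operators considered: differential operators with coefficients affine in \<open>x\<close>.
\<close>

definition stein_operator ::
    "(nat \<Rightarrow> real) \<Rightarrow> (nat \<Rightarrow> real) \<Rightarrow> nat \<Rightarrow> (nat \<Rightarrow> real \<Rightarrow> real) \<Rightarrow> real \<Rightarrow> real" where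
  "stein_operator \<alpha> \<beta> m F x = (\<Sum>j\<le>m. (\<alpha> j * x + \<beta> j) * F j x)"

text \<open>
  Multiply \<open>F\<close> by the cutoff \<open>\<eta>(x / n)\<close> and let \<open>n\<close> tend to infinity. In the Leibniz formula for the \<open>j\<close>-th
  derivative, the term with \<open>F j\<close> converges by dominated convergence. A term with \<open>F i\<close>, \<open>i < j\<close>, contains
  a derivative \<open>\<psi>\<close> of the scaled cutoff of positive order, for which \<open>\<psi>\<close> and \<open>x \<psi>(x)\<close> are bounded uniformly in \<open>n\<close> and
  \<open>\<psi> = O(1 / n)\<close>. It is therefore dominated by a multiple of \<open>\<bar>F i\<bar>\<close> and tends to \<open>0\<close>. At top order
  \<open>\<beta> m = 0\<close> makes the integrability of \<open>T F m (T)\<close> sufficient.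
\<close>

lemma (in prob_space) stein_identity_extend:
  assumes T [measurable]: "random_variable borel T"
    and H: "\<And>F. bounded_derivs m F \<Longrightarrow> expectation (\<lambda>\<omega>. stein_operator \<alpha> \<beta> m F (T \<omega>)) = 0"
    and \<beta>m: "\<beta> m = 0"
    and F: "derivs m F"
    and int: "\<And>j. j < m \<Longrightarrow> integrable M (\<lambda>\<omega>. F j (T \<omega>))"
    and intT: "\<And>j. j \<le> m \<Longrightarrow> integrable M (\<lambda>\<omega>. T \<omega> * F j (T \<omega>))"
  shows "has_bochner_integral M (\<lambda>\<omega>. stein_operator \<alpha> \<beta> m F (T \<omega>)) 0"
proof -
  define N where "N = (\<lambda>n. real (Suc n))"
  have N: "N n \<ge> 1" for n by (simp add: N_def)
  obtain \<eta> where \<eta>: "derivs m \<eta>" and \<eta>0: "\<And>j x. j \<le> m \<Longrightarrow> \<bar>x\<bar> \<ge> 1 \<Longrightarrow> \<eta> j x = 0" and \<eta>1: "\<eta> 0 0 = 1"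
    using derivs_cutoff[of m] by blast
  obtain K where K: "\<And>j x. j \<le> m \<Longrightarrow> \<bar>\<eta> j x\<bar> \<le> K"
    using bounded_derivs_bound[OF bounded_derivs_compact_support[OF \<eta> \<eta>0]] by blast
  have K0: "K \<ge> 0" using K[of 0 0] by simp
  define \<psi> where "\<psi> = (\<lambda>n j x. (1 / N n) ^ j * \<eta> j (1 / N n * x + 0))"
  have \<psi>: "derivs m (\<psi> n)" for n unfolding \<psi>_def by (rule derivs_affine[OF \<eta>])
  have \<psi>0: "\<psi> n j x = 0" if "j \<le> m" "\<bar>x\<bar> \<ge> N n" for n j x
    using \<eta>0[OF that(1), of "x / N n"] that(2) N[of n] by (simp add: \<psi>_def)
  have \<psi>K: "\<bar>\<psi> n j x\<bar> \<le> K" if "j \<le> m" for n j x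
  proof -
    have "\<bar>(1 / N n) ^ j\<bar> \<le> 1" using N[of n] by (simp add: power_le_one)
    thus ?thesis using mult_mono[OF _ K[OF that, of "1 / N n * x + 0"], of "\<bar>(1 / N n) ^ j\<bar>" 1]
      by (simp add: \<psi>_def abs_mult)
  qed
  have \<psi>K': "\<bar>\<psi> n j x\<bar> \<le> K / N n" if "j \<le> m" "j > 0" for n j x
  proof -
    have "(1 / N n) ^ j \<le> (1 / N n) ^ 1" using that N[of n] by (intro power_decreasing) auto
    hence "\<bar>(1 / N n) ^ j\<bar> \<le> 1 / N n" using N[of n] by simp
    thus ?thesis using mult_mono[OF _ K[OF that(1), of "1 / N n * x + 0"], of "\<bar>(1 / N n) ^ j\<bar>" "1 / N n"] N[of n]
      by (simp add: \<psi>_def abs_mult)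
  qed
  have \<psi>x: "\<bar>x * \<psi> n j x\<bar> \<le> K" if "j \<le> m" "j > 0" for n j x
  proof (cases "\<bar>x\<bar> \<ge> N n")
    case False
    hence "\<bar>x\<bar> * \<bar>\<psi> n j x\<bar> \<le> N n * (K / N n)"
      using \<psi>K'[OF that] N[of n] by (intro mult_mono) auto
    thus ?thesis using N[of n] by (simp add: abs_mult)
  qed (use \<psi>0[OF that(1)] K0 in simp)
  have Nlim: "(\<lambda>n. 1 / N n) \<longlonglongrightarrow> 0"
    unfolding N_def using lim_inverse_n'[THEN LIMSEQ_Suc] by simp
  have \<psi>lim: "(\<lambda>n. \<psi> n j x) \<longlonglongrightarrow> (if j = 0 then 1 else 0)" if "j \<le> m" for j x
  proof (cases "j = 0")
    case True
    have "isCont (\<eta> 0) 0" using derivs_continuous[OF \<eta>, of 0] by (simp add: continuous_on_eq_continuous_at)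
    moreover have "(\<lambda>n. 1 / N n * x + 0) \<longlonglongrightarrow> 0"
      using tendsto_mult_left_zero[OF Nlim, of x] by simp
    ultimately have "(\<lambda>n. \<eta> 0 (1 / N n * x + 0)) \<longlonglongrightarrow> \<eta> 0 0" by (rule isCont_tendsto_compose)
    thus ?thesis using True \<eta>1 by (simp add: \<psi>_def)
  next
    case False
    have "(\<lambda>n. K * (1 / N n)) \<longlonglongrightarrow> 0" by (rule tendsto_mult_right_zero[OF Nlim])
    hence "(\<lambda>n. \<psi> n j x) \<longlonglongrightarrow> 0"
      by (rule Lim_null_comparison[rotated]) (use \<psi>K'[OF that] False in auto)
    thus ?thesis using False by simp
  qed
  define c where "c = (\<lambda>j x. \<alpha> j * x + \<beta> j)"
  have [measurable]: "F j \<in> borel_measurable borel" if "j \<le> m" for j by (rule derivs_measurable[OF F that])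
  have [measurable]: "\<psi> n j \<in> borel_measurable borel" if "j \<le> m" for n j by (rule derivs_measurable[OF \<psi> that])
  have [measurable]: "c j \<in> borel_measurable borel" for j unfolding c_def by simp
  have intc: "integrable M (\<lambda>\<omega>. c j (T \<omega>) * F j (T \<omega>))" if "j \<le> m" for j
  proof (cases "j = m")
    case True
    thus ?thesis using intT[of m] \<beta>m by (simp add: c_def mult.assoc)
  next
    case False
    hence "integrable M (\<lambda>\<omega>. \<alpha> j * (T \<omega> * F j (T \<omega>)) + \<beta> j * F j (T \<omega>))"
      using that int[of j] intT[of j] by (intro Bochner_Integration.integrable_add integrable_mult_right) auto
    thus ?thesis by (simp add: c_def algebra_simps)
  qed
  have trm: "(\<forall>n. integrable M (\<lambda>\<omega>. c j (T \<omega>) * (F i (T \<omega>) * \<psi> n (j - i) (T \<omega>)))) \<and>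
      (\<lambda>n. expectation (\<lambda>\<omega>. c j (T \<omega>) * (F i (T \<omega>) * \<psi> n (j - i) (T \<omega>))))
        \<longlonglongrightarrow> (if i = j then expectation (\<lambda>\<omega>. c j (T \<omega>) * F j (T \<omega>)) else 0)"
    if "i \<le> j" "j \<le> m" for i j
  proof -
    define w where "w = (\<lambda>x. if i = j then K * \<bar>c j x * F j x\<bar> else (\<bar>\<alpha> j\<bar> + \<bar>\<beta> j\<bar>) * K * \<bar>F i x\<bar>)"
    let ?s = "\<lambda>n \<omega>. c j (T \<omega>) * (F i (T \<omega>) * \<psi> n (j - i) (T \<omega>))"
    let ?f = "\<lambda>\<omega>. if i = j then c j (T \<omega>) * F j (T \<omega>) else 0"
    have m1: "?f \<in> borel_measurable M" using that by (cases "i = j") auto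
    have m2: "?s n \<in> borel_measurable M" for n
      using that by (intro borel_measurable_times measurable_compose[OF T]) auto
    have w: "integrable M (\<lambda>\<omega>. w (T \<omega>))"
      using that intc[of j] int[of i] by (cases "i = j") (auto simp: w_def)
    have lim: "(\<lambda>n. ?s n \<omega>) \<longlonglongrightarrow> ?f \<omega>" for \<omega>
    proof -
      have "(\<lambda>n. ?s n \<omega>) \<longlonglongrightarrow> c j (T \<omega>) * (F i (T \<omega>) * (if j - i = 0 then 1 else 0))"
        using that by (intro tendsto_intros \<psi>lim) auto
      thus ?thesis using that by (auto split: if_splits)
    qed
    have bd: "norm (?s n \<omega>) \<le> w (T \<omega>)" for n \<omega>
    proof -
      define x where "x = T \<omega>"
      have "\<bar>c j x * (F i x * \<psi> n (j - i) x)\<bar> \<le> w x"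
      proof (cases "i = j")
        case True
        have "\<bar>c j x * F j x\<bar> * \<bar>\<psi> n 0 x\<bar> \<le> \<bar>c j x * F j x\<bar> * K" by (intro mult_left_mono \<psi>K) auto
        thus ?thesis using True by (simp add: w_def abs_mult mult_ac)
      next
        case False
        have *: "\<bar>x * \<psi> n (j - i) x\<bar> \<le> K" "\<bar>\<psi> n (j - i) x\<bar> \<le> K"
          using \<psi>x[of "j - i" x n] \<psi>K[of "j - i" n x] False that by auto
        have "\<bar>c j x * \<psi> n (j - i) x\<bar> \<le> \<bar>\<alpha> j\<bar> * \<bar>x * \<psi> n (j - i) x\<bar> + \<bar>\<beta> j\<bar> * \<bar>\<psi> n (j - i) x\<bar>"
          unfolding c_def distrib_right using abs_triangle_ineq[of "\<alpha> j * x * \<psi> n (j - i) x" "\<beta> j * \<psi> n (j - i) x"]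
          by (simp add: abs_mult mult_ac)
        also have "\<dots> \<le> \<bar>\<alpha> j\<bar> * K + \<bar>\<beta> j\<bar> * K" using * by (intro add_mono mult_left_mono) auto
        finally have "\<bar>c j x * \<psi> n (j - i) x\<bar> * \<bar>F i x\<bar> \<le> (\<bar>\<alpha> j\<bar> * K + \<bar>\<beta> j\<bar> * K) * \<bar>F i x\<bar>"
          by (intro mult_right_mono) auto
        thus ?thesis using False by (simp add: w_def abs_mult algebra_simps)
      qed
      thus ?thesis by (simp add: x_def)
    qed
    have "(\<lambda>n. expectation (?s n)) \<longlonglongrightarrow> expectation ?f"
      by (rule integral_dominated_convergence[OF m1 m2 w]) (use lim bd in auto)
    moreover have "integrable M (?s n)" for n
      by (rule integrable_dominated_convergence2[OF m1 m2 w]) (use lim bd in auto)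
    moreover have "expectation ?f = (if i = j then expectation (\<lambda>\<omega>. c j (T \<omega>) * F j (T \<omega>)) else 0)"
      by simp
    ultimately show ?thesis by simp
  qed
  define G where "G = (\<lambda>n. leibniz F (\<psi> n))"
  have G: "bounded_derivs m (G n)" for n
  proof (rule bounded_derivs_compact_support)
    show "derivs m (G n)" unfolding G_def by (intro derivs_leibniz F \<psi>)
    show "G n j x = 0" if "j \<le> m" "\<bar>x\<bar> \<ge> N n" for j x
      unfolding G_def leibniz_def using that \<psi>0 by (intro sum.neutral) auto
  qed
  have eq: "stein_operator \<alpha> \<beta> m (G n) x
      = (\<Sum>j\<le>m. \<Sum>i\<le>j. real (j choose i) * (c j x * (F i x * \<psi> n (j - i) x)))" for n x
    by (simp add: stein_operator_def G_def leibniz_def c_def sum_distrib_left mult_ac)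
  have "expectation (\<lambda>\<omega>. stein_operator \<alpha> \<beta> m (G n) (T \<omega>))
      = (\<Sum>j\<le>m. \<Sum>i\<le>j. real (j choose i) * expectation (\<lambda>\<omega>. c j (T \<omega>) * (F i (T \<omega>) * \<psi> n (j - i) (T \<omega>))))" for n
  proof -
    let ?t = "\<lambda>j i \<omega>. real (j choose i) * (c j (T \<omega>) * (F i (T \<omega>) * \<psi> n (j - i) (T \<omega>)))"
    have int: "integrable M (?t j i)" if "i \<le> j" "j \<le> m" for i j
      using trm[OF that] by simp
    have "expectation (\<lambda>\<omega>. stein_operator \<alpha> \<beta> m (G n) (T \<omega>)) = (\<Sum>j\<le>m. expectation (\<lambda>\<omega>. \<Sum>i\<le>j. ?t j i \<omega>))"
      unfolding eq by (rule Bochner_Integration.integral_sum) (intro Bochner_Integration.integrable_sum int; simp)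
    also have "\<dots> = (\<Sum>j\<le>m. \<Sum>i\<le>j. expectation (?t j i))"
      by (intro sum.cong refl Bochner_Integration.integral_sum int; simp)
    finally show ?thesis by simp
  qed
  moreover have "(\<lambda>n. \<Sum>j\<le>m. \<Sum>i\<le>j. real (j choose i) * expectation (\<lambda>\<omega>. c j (T \<omega>) * (F i (T \<omega>) * \<psi> n (j - i) (T \<omega>))))
      \<longlonglongrightarrow> (\<Sum>j\<le>m. \<Sum>i\<le>j. real (j choose i) * (if i = j then expectation (\<lambda>\<omega>. c j (T \<omega>) * F j (T \<omega>)) else 0))"
    using trm by (intro tendsto_sum tendsto_mult tendsto_const) auto
  ultimately have "(\<Sum>j\<le>m. \<Sum>i\<le>j. real (j choose i) * (if i = j then expectation (\<lambda>\<omega>. c j (T \<omega>) * F j (T \<omega>)) else 0)) = 0"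
    using H[OF G] by (simp add: LIMSEQ_const_iff)
  hence "(\<Sum>j\<le>m. expectation (\<lambda>\<omega>. c j (T \<omega>) * F j (T \<omega>))) = 0"
    by (simp add: if_distrib cong: if_cong)
  moreover have "stein_operator \<alpha> \<beta> m F x = (\<Sum>j\<le>m. c j x * F j x)" for x
    by (simp add: stein_operator_def c_def)
  ultimately show ?thesis
    using intc by (auto simp: has_bochner_integral_iff intro!: Bochner_Integration.integrable_sum)
qed

section \<open>The differential equation of the characteristic function\<close>

lemma has_vector_derivative_iexp_scaled:
  "((\<lambda>t. iexp (t * x)) has_vector_derivative \<i> * x * iexp (t * x)) (at t)"
proof -
  have "((\<lambda>t::real. t * x) has_vector_derivative x) (at t)"
    by (auto intro!: derivative_eq_intros simp: has_real_derivative_iff_has_vector_derivative[symmetric])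
  from vector_diff_chain_at[OF this has_vector_derivative_iexp]
  show ?thesis by (simp add: comp_def scaleR_conv_of_real mult_ac)
qed

lemma norm_iexp_diff_le: "norm (iexp ((t + h) * x) - iexp (t * x)) \<le> \<bar>h\<bar> * \<bar>x\<bar>"
proof -
  have "iexp ((t + h) * x) - iexp (t * x) = iexp (t * x) * (iexp (h * x) - 1)"
    by (simp add: distrib_right distrib_left exp_add algebra_simps)
  moreover have "norm (iexp (h * x) - 1) \<le> \<bar>h * x\<bar>" using iexp_approx1[of "h * x" 0] by simp
  ultimately show ?thesis by (simp add: norm_mult abs_mult)
qed

text \<open>
  Differentiation under the integral: \<open>e h x\<close> is the error of the difference quotient, normalised by \<open>\<bar>h\<bar>\<close>. It
  is dominated by \<open>2 \<bar>x\<bar>\<close>, which is integrable by the assumption of a first moment.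
\<close>

lemma (in real_distribution) has_vector_derivative_char:
  assumes int: "integrable M (\<lambda>x. x)"
  shows "(char M has_vector_derivative (CLINT x|M. \<i> * x * iexp (t * x))) (at t)"
proof -
  define D where "D = (CLINT x|M. \<i> * x * iexp (t * x))"
  define e where "e = (\<lambda>h x. (iexp ((t + h) * x) - iexp (t * x) - h *\<^sub>R (\<i> * x * iexp (t * x))) /\<^sub>R \<bar>h\<bar>)"
  have bound: "norm (e h x) \<le> 2 * \<bar>x\<bar>" if "h \<noteq> 0" for h x
  proof -
    have "norm (iexp ((t + h) * x) - iexp (t * x) - h *\<^sub>R (\<i> * x * iexp (t * x)))
        \<le> \<bar>h\<bar> * \<bar>x\<bar> + \<bar>h\<bar> * \<bar>x\<bar>"
      by (rule order.trans[OF norm_triangle_ineq4 add_mono[OF norm_iexp_diff_le]]) (simp add: norm_mult)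
    thus ?thesis using that by (simp add: e_def divide_simps mult_ac)
  qed
  have lim: "((\<lambda>h. e h x) \<longlongrightarrow> 0) (at 0)" for x
    using has_vector_derivative_iexp_scaled[of x t]
    unfolding has_vector_derivative_def has_derivative_at e_def
    by (subst tendsto_norm_zero_iff[symmetric]) (simp add: divide_inverse mult.commute)
  have intI: "integrable M (\<lambda>x. iexp (s * x))" for s by (rule integrable_iexp) auto
  have intD: "integrable M (\<lambda>x. \<i> * x * iexp (t * x))"
  proof (rule Bochner_Integration.integrable_bound[OF int])
    show "AE x in M. norm (\<i> * x * iexp (t * x)) \<le> norm x" by (simp add: norm_mult)
  qed simp
  have eq: "(char M (t + h) - char M t - h *\<^sub>R D) /\<^sub>R \<bar>h\<bar> = (CLINT x|M. e h x)" for h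
    unfolding char_def D_def e_def using intI[of "t + h"] intI[of t] intD by simp
  have "((\<lambda>h. CLINT x|M. e h x) \<longlongrightarrow> 0) (at 0)"
    unfolding tendsto_at_iff_sequentially
  proof (intro allI impI)
    fix X :: "nat \<Rightarrow> real" assume X: "\<forall>i. X i \<in> UNIV - {0}" "X \<longlonglongrightarrow> 0"
    have "(\<lambda>n. CLINT x|M. e (X n) x) \<longlonglongrightarrow> (CLINT x|M. 0)"
    proof (rule integral_dominated_convergence[where w = "\<lambda>x. 2 * \<bar>x\<bar>"])
      show "AE x in M. (\<lambda>n. e (X n) x) \<longlonglongrightarrow> 0"
        using lim X unfolding tendsto_at_iff_sequentially comp_def by blast
      show "AE x in M. norm (e (X n) x) \<le> 2 * \<bar>x\<bar>" for n using bound X by auto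
      show "integrable M (\<lambda>x. 2 * \<bar>x\<bar>)" using int by simp
    qed (auto simp: e_def)
    thus "((\<lambda>h. CLINT x|M. e h x) \<circ> X) \<longlonglongrightarrow> 0" by (simp add: comp_def)
  qed
  hence "((\<lambda>h. (char M (t + h) - char M t - h *\<^sub>R D) /\<^sub>R \<bar>h\<bar>) \<longlongrightarrow> 0) (at 0)" by (simp add: eq)
  hence "(char M has_vector_derivative D) (at t)"
    unfolding has_vector_derivative_def has_derivative_at
    by (subst (asm) tendsto_norm_zero_iff[symmetric])
       (auto simp: divide_inverse mult.commute intro!: bounded_linear_scaleR_left)
  thus ?thesis by (simp add: D_def)
qed

text \<open>
  The difference \<open>d\<close> of two solutions satisfies \<open>d' = a d\<close>. With an antiderivative \<open>A\<close> of \<open>a\<close> on a compact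
  interval around \<open>0\<close> and the given point, \<open>d exp (- A)\<close> is constant and vanishes at \<open>0\<close>.
\<close>

lemma first_order_linear_ode_unique:
  fixes \<phi> \<psi> :: "real \<Rightarrow> complex"
  assumes d\<phi>: "\<And>t. (\<phi> has_vector_derivative \<phi>' t) (at t)" and d\<psi>: "\<And>t. (\<psi> has_vector_derivative \<psi>' t) (at t)"
    and p: "continuous_on UNIV p" "\<And>t. p t \<noteq> 0" and q: "continuous_on UNIV q"
    and ode\<phi>: "\<And>t. p t * \<phi>' t = q t * \<phi> t" and ode\<psi>: "\<And>t. p t * \<psi>' t = q t * \<psi> t"
    and init: "\<phi> 0 = \<psi> 0"
  shows "\<phi> = \<psi>"
proof
  fix t :: real
  define R where "R = \<bar>t\<bar>"
  define a where "a = (\<lambda>t. q t / p t)"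
  define d where "d = (\<lambda>t. \<phi> t - \<psi> t)"
  have d': "(d has_vector_derivative a s * d s) (at s)" for s
  proof -
    have "\<phi>' s - \<psi>' s = a s * d s"
      using ode\<phi>[of s] ode\<psi>[of s] p(2)[of s] by (simp add: a_def d_def field_simps)
    thus ?thesis using has_vector_derivative_diff[OF d\<phi>[of s] d\<psi>[of s]] by (simp add: d_def[abs_def])
  qed
  have "continuous_on {-R..R} a"
    unfolding a_def using p q by (auto intro!: continuous_intros intro: continuous_on_subset)
  then obtain A where A: "\<And>s. s \<in> {-R..R} \<Longrightarrow> (A has_vector_derivative a s) (at s within {-R..R})"
    using antiderivative_continuous by blast
  have "((\<lambda>s. d s * exp (- A s)) has_vector_derivative 0) (at s within {-R..R})" if "s \<in> {-R..R}" for s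
  proof -
    have "((\<lambda>s. - A s) has_vector_derivative - a s) (at s within {-R..R})"
      using A[OF that] by (rule has_vector_derivative_minus)
    from field_vector_diff_chain_within[OF this, of exp "exp (- A s)"]
    have "((\<lambda>s. exp (- A s)) has_vector_derivative - a s * exp (- A s)) (at s within {-R..R})"
      by (simp add: comp_def DERIV_exp[THEN has_field_derivative_at_within])
    from has_vector_derivative_mult[OF has_vector_derivative_at_within[OF d'] this]
    show ?thesis by (simp add: algebra_simps)
  qed
  then obtain c where c: "\<And>s. s \<in> {-R..R} \<Longrightarrow> d s * exp (- A s) = c"
    using has_vector_derivative_zero_constant[of "{-R..R}" "\<lambda>s. d s * exp (- A s)"] by auto
  have "d 0 = 0" using init by (simp add: d_def)
  hence "c = 0" using c[of 0] by (simp add: R_def)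
  moreover have "t \<in> {-R..R}" using abs_ge_minus_self[of t] by (simp add: R_def)
  ultimately have "d t = 0" using c[of t] by simp
  thus "\<phi> t = \<psi> t" by (simp add: d_def)
qed

text \<open>
  With \<open>c = 1\<close> and \<open>c = - i\<close> these are the cosine and the sine of \<open>t x\<close>.
\<close>

lemma bounded_derivs_iexp:
  "bounded_derivs m (\<lambda>j x. Re (c * (\<i> * t) ^ j * iexp (t * x)))"
  unfolding bounded_derivs_def derivs_def
proof (intro conjI allI impI)
  fix j x
  have "((\<lambda>x. iexp (t * x)) has_vector_derivative \<i> * t * iexp (t * x)) (at x)"
    using has_vector_derivative_iexp_scaled[of t x] by (simp add: mult.commute)
  from bounded_linear.has_vector_derivative[OF bounded_linear_Re
      has_vector_derivative_mult_right[OF this, of "c * (\<i> * t) ^ j"]]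
  show "((\<lambda>x. Re (c * (\<i> * t) ^ j * iexp (t * x))) has_real_derivative
      Re (c * (\<i> * t) ^ Suc j * iexp (t * x))) (at x)"
    by (simp only: has_real_derivative_iff_has_vector_derivative power_Suc mult_ac)
next
  show "continuous_on UNIV (\<lambda>x. Re (c * (\<i> * t) ^ m * iexp (t * x)))" by (intro continuous_intros)
next
  fix j
  have "\<bar>Re (c * (\<i> * t) ^ j * iexp (t * x))\<bar> \<le> norm (c * (\<i> * t) ^ j)" for x
    using abs_Re_le_cmod[of "c * (\<i> * t) ^ j * iexp (t * x)"] by (simp add: norm_mult)
  thus "bounded (range (\<lambda>x. Re (c * (\<i> * t) ^ j * iexp (t * x))))" by (auto simp: bounded_iff)
qed

text \<open>
  On \<open>iexp (t x)\<close> the operator acts as multiplication by \<open>P x + Q\<close>, where \<open>P\<close> and \<open>Q\<close> are the values at \<open>i t\<close> of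
  the polynomials with coefficients \<open>\<alpha>\<close> and \<open>\<beta>\<close>. Its vanishing expectation relates \<open>E[X iexp (t X)]\<close>, the
  derivative of the characteristic function up to the factor \<open>i\<close>, to the characteristic function.
\<close>

lemma (in real_distribution) char_ode:
  assumes int: "integrable M (\<lambda>x. x)"
    and H: "\<And>F. bounded_derivs m F \<Longrightarrow> expectation (stein_operator \<alpha> \<beta> m F) = 0"
  shows "(\<Sum>j\<le>m. \<alpha> j * (\<i> * t) ^ j) * (CLINT x|M. \<i> * x * iexp (t * x))
       = (- \<i> * (\<Sum>j\<le>m. \<beta> j * (\<i> * t) ^ j)) * char M t"
proof -
  let ?P = "\<Sum>j\<le>m. \<alpha> j * (\<i> * t) ^ j" and ?Q = "\<Sum>j\<le>m. \<beta> j * (\<i> * t) ^ j"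
  define g where "g = (\<lambda>x. (?P * x + ?Q) * iexp (t * x))"
  have intI: "integrable M (\<lambda>x. iexp (t * x))" by (rule integrable_iexp) auto
  have intX: "integrable M (\<lambda>x. x * iexp (t * x))"
  proof (rule Bochner_Integration.integrable_bound[OF int])
    show "AE x in M. norm (x * iexp (t * x)) \<le> norm x" by (simp add: norm_mult)
  qed simp
  have g: "g x = ?P * (x * iexp (t * x)) + ?Q * iexp (t * x)" for x by (simp add: g_def algebra_simps)
  have intg: "integrable M g" unfolding g using intI intX by simp
  have op: "stein_operator \<alpha> \<beta> m (\<lambda>j x. Re (c * (\<i> * t) ^ j * iexp (t * x))) x = Re (c * g x)" for c x
  proof -
    have Re_of_real_mult: "Re (of_real r * z) = r * Re z" for r z by simp
    have "c * g x = (\<Sum>j\<le>m. of_real (\<alpha> j * x + \<beta> j) * (c * (\<i> * t) ^ j * iexp (t * x)))"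
      by (simp add: g_def sum_distrib_left sum_distrib_right sum.distrib[symmetric] algebra_simps)
    hence "Re (c * g x) = (\<Sum>j\<le>m. Re (of_real (\<alpha> j * x + \<beta> j) * (c * (\<i> * t) ^ j * iexp (t * x))))"
      by (simp only: Re_sum)
    thus ?thesis unfolding stein_operator_def by (simp only: Re_of_real_mult)
  qed
  \<comment> \<open>The hypothesis concerns real functions, so it yields real parts; \<open>c = 1\<close> and \<open>c = - i\<close> recover the complex value.\<close>
  have z: "Re (c * integral\<^sup>L M g) = 0" for c
  proof -
    have "Re (c * integral\<^sup>L M g) = Re (CLINT x|M. c * g x)" by simp
    also have "\<dots> = (LINT x|M. Re (c * g x))" using intg by (intro integral_Re[symmetric]) simp
    also have "(\<lambda>x. Re (c * g x)) = stein_operator \<alpha> \<beta> m (\<lambda>j x. Re (c * (\<i> * t) ^ j * iexp (t * x)))"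
      by (rule ext, rule op[symmetric])
    also have "expectation \<dots> = 0" by (rule H[OF bounded_derivs_iexp])
    finally show ?thesis .
  qed
  have "integral\<^sup>L M g = 0" using z[of 1] z[of "- \<i>"] by (simp add: complex_eq_iff)
  hence "?P * (CLINT x|M. x * iexp (t * x)) + ?Q * char M t = 0"
    unfolding g char_def using intI intX by simp
  hence PX: "?P * (CLINT x|M. x * iexp (t * x)) = - (?Q * char M t)"
    by (simp only: eq_neg_iff_add_eq_0)
  have "?P * (CLINT x|M. \<i> * x * iexp (t * x)) = \<i> * (?P * (CLINT x|M. x * iexp (t * x)))"
    by (simp only: mult.assoc integral_mult_right_zero mult.left_commute)
  also have "\<dots> = (- \<i> * ?Q) * char M t"
    unfolding PX by (simp only: mult_minus_right mult_minus_left mult.assoc)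
  finally show ?thesis .
qed

text \<open>
  Both characteristic functions solve the equation of \<open>char_ode\<close> with the value \<open>1\<close> at \<open>0\<close>. The condition on the
  symbol keeps the equation regular, so the solution is unique on the whole line.
\<close>

lemma real_distribution_stein_unique:
  assumes M: "real_distribution M" "integrable M (\<lambda>x. x)" and N: "real_distribution N" "integrable N (\<lambda>x. x)"
    and HM: "\<And>F. bounded_derivs m F \<Longrightarrow> integral\<^sup>L M (stein_operator \<alpha> \<beta> m F) = 0"
    and HN: "\<And>F. bounded_derivs m F \<Longrightarrow> integral\<^sup>L N (stein_operator \<alpha> \<beta> m F) = 0"
    and P: "\<And>t::real. (\<Sum>j\<le>m. \<alpha> j * (\<i> * t) ^ j) \<noteq> 0"
  shows "M = N"
proof (rule Levy_uniqueness[OF M(1) N(1)])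
  show "char M = char N"
  proof (rule first_order_linear_ode_unique)
    show "(char M has_vector_derivative (CLINT x|M. \<i> * x * iexp (t * x))) (at t)" for t
      by (rule real_distribution.has_vector_derivative_char[OF M])
    show "(char N has_vector_derivative (CLINT x|N. \<i> * x * iexp (t * x))) (at t)" for t
      by (rule real_distribution.has_vector_derivative_char[OF N])
    show "(\<Sum>j\<le>m. \<alpha> j * (\<i> * t) ^ j) * (CLINT x|M. \<i> * x * iexp (t * x))
       = (- \<i> * (\<Sum>j\<le>m. \<beta> j * (\<i> * t) ^ j)) * char M t" for t
      by (rule real_distribution.char_ode[OF M HM])
    show "(\<Sum>j\<le>m. \<alpha> j * (\<i> * t) ^ j) * (CLINT x|N. \<i> * x * iexp (t * x))
       = (- \<i> * (\<Sum>j\<le>m. \<beta> j * (\<i> * t) ^ j)) * char N t" for t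
      by (rule real_distribution.char_ode[OF N HN])
    show "char M 0 = char N 0"
      using real_distribution.char_zero[OF M(1)] real_distribution.char_zero[OF N(1)] by simp
  qed (auto intro!: continuous_intros P)
qed

section \<open>Characterization of the law\<close>

lemma (in prob_space) bounded_derivs_in_stein_class:
  assumes T: "integrable M T" and F: "bounded_derivs m F"
  shows "F 0 \<in> stein_class M T m"
proof -
  note i = integrable_times_bounded_derivs[OF T borel_measurable_integrable[OF T] F]
  show ?thesis
    using derivs_imp_C_diff[OF bounded_derivsD[OF F]] derivs_deriv_iterate[OF bounded_derivsD[OF F]] i
    by (auto simp: stein_class_def)
qed

lemma stein_operator_measurable:
  "derivs m F \<Longrightarrow> stein_operator \<alpha> \<beta> m F \<in> borel_measurable borel"
  unfolding stein_operator_def[abs_def]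
  by (intro borel_measurable_sum borel_measurable_times) (auto intro: derivs_measurable)

text \<open>
  An abstract Stein characterization: it remains to know the identity for \<open>T\<close> on functions with bounded
  derivatives and that the symbol of the part of the operator multiplied by \<open>x\<close> has no real zero. Necessity
  is the cutoff argument; for sufficiency, functions with bounded derivatives already determine the law.
\<close>

theorem stein_characterization:
  fixes M :: "'a measure" and N :: "'b measure" and T :: "'a \<Rightarrow> real" and W :: "'b \<Rightarrow> real"
  assumes M: "prob_space M" and N: "prob_space N" and T: "integrable M T" and W: "integrable N W"
    and \<beta>m: "\<beta> m = 0" and P: "\<And>t::real. (\<Sum>j\<le>m. \<alpha> j * (\<i> * t) ^ j) \<noteq> 0"
    and H: "\<And>F. bounded_derivs m F \<Longrightarrow> integral\<^sup>L M (\<lambda>\<omega>. stein_operator \<alpha> \<beta> m F (T \<omega>)) = 0"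
  shows "distr N borel W = distr M borel T \<longleftrightarrow>
    (\<forall>f\<in>stein_class M T m. has_bochner_integral N (\<lambda>\<omega>. stein_operator \<alpha> \<beta> m (\<lambda>j. (deriv ^^ j) f) (W \<omega>)) 0)"
proof
  interpret M: prob_space M by (rule M)
  interpret N: prob_space N by (rule N)
  have [measurable]: "T \<in> borel_measurable M" "W \<in> borel_measurable N" using T W by auto
  {
    assume eq: "distr N borel W = distr M borel T"
    show "\<forall>f\<in>stein_class M T m. has_bochner_integral N (\<lambda>\<omega>. stein_operator \<alpha> \<beta> m (\<lambda>j. (deriv ^^ j) f) (W \<omega>)) 0"
    proof
      fix f assume f: "f \<in> stein_class M T m"
      let ?A = "stein_operator \<alpha> \<beta> m (\<lambda>j. (deriv ^^ j) f)"
      have d: "derivs m (\<lambda>j. (deriv ^^ j) f)" using f by (simp add: stein_class_def C_diff_iff_derivs)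
      have [measurable]: "?A \<in> borel_measurable borel" by (rule stein_operator_measurable[OF d])
      have "has_bochner_integral M (\<lambda>\<omega>. ?A (T \<omega>)) 0"
        using f by (intro M.stein_identity_extend[OF _ H \<beta>m d]) (auto simp: stein_class_def)
      hence "has_bochner_integral (distr M borel T) ?A 0"
        by (simp add: has_bochner_integral_iff integrable_distr_eq integral_distr)
      thus "has_bochner_integral N (\<lambda>\<omega>. ?A (W \<omega>)) 0"
        unfolding eq[symmetric] by (simp add: has_bochner_integral_iff integrable_distr_eq integral_distr)
    qed
  }
  {
    assume h: "\<forall>f\<in>stein_class M T m. has_bochner_integral N (\<lambda>\<omega>. stein_operator \<alpha> \<beta> m (\<lambda>j. (deriv ^^ j) f) (W \<omega>)) 0"
    show "distr N borel W = distr M borel T"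
    proof (rule real_distribution_stein_unique[OF _ _ _ _ _ _ P])
      show "real_distribution (distr N borel W)" "real_distribution (distr M borel T)"
        by (auto intro!: N.real_distribution_distr M.real_distribution_distr)
      show "integrable (distr N borel W) (\<lambda>x. x)" "integrable (distr M borel T) (\<lambda>x. x)"
        using T W by (simp_all add: integrable_distr_eq)
      fix F assume F: "bounded_derivs m F"
      have [measurable]: "stein_operator \<alpha> \<beta> m F \<in> borel_measurable borel"
        by (rule stein_operator_measurable[OF bounded_derivsD[OF F]])
      show "integral\<^sup>L (distr M borel T) (stein_operator \<alpha> \<beta> m F) = 0"
        using H[OF F] by (simp add: integral_distr)
      have "stein_operator \<alpha> \<beta> m (\<lambda>j. (deriv ^^ j) (F 0)) = stein_operator \<alpha> \<beta> m F"
        using derivs_deriv_iterate[OF bounded_derivsD[OF F]] by (simp add: stein_operator_def fun_eq_iff)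
      thus "integral\<^sup>L (distr N borel W) (stein_operator \<alpha> \<beta> m F) = 0"
        using h M.bounded_derivs_in_stein_class[OF T F]
        by (auto simp: integral_distr has_bochner_integral_iff)
    qed
  }
qed

text \<open>
  Here \<open>H = S'\<^sup>2 F\<close> and \<open>K = S\<^sup>2 F\<close>. The identity for \<open>V1\<close> applied to \<open>H\<close> and the one for \<open>V2\<close> applied to \<open>K\<close>
  both contain \<open>S\<^sup>2 S'\<^sup>2 F\<close> and are subtracted. The roles of the variables are exchanged for \<open>V2\<close>, hence the
  reflection of \<open>K\<close>: it is evaluated at \<open>V2 - V1\<close>.
\<close>

lemma (in prob_space) chi_square_difference_stein_op1:
  assumes r: "r > 0" and l: "l1 \<ge> 0" "l2 \<ge> 0"
    and V1: "distributed M lborel V1 (\<lambda>x. ennreal (noncentral_chi_square_density r l1 x))"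
    and V2: "distributed M lborel V2 (\<lambda>x. ennreal (noncentral_chi_square_density r l2 x))"
    and indep: "indep_var borel V1 borel V2" and F: "bounded_derivs 4 F"
  shows "has_bochner_integral M (\<lambda>\<omega>. stein_operator (nth [1, 0, -8, 0, 16])
     (nth [-(l1 - l2), -4 * (l1 + l2 + r), -4 * (l1 - l2), 16 * r, 0]) 4 F (V1 \<omega> - V2 \<omega>)) 0"
proof -
  define H where "H = (\<lambda>j x. \<Sum>i\<le>2. [1, 4, 4] ! i * F (j + i) x)"
  define K where "K = (\<lambda>j x. \<Sum>i\<le>2. [1, -4, 4] ! i * F (j + i) x)"
  have H: "bounded_derivs 2 H" unfolding H_def by (rule bounded_derivs_comb) (use F in simp)
  have K: "bounded_derivs 2 K" unfolding K_def by (rule bounded_derivs_comb) (use F in simp)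
  note 1 = noncentral_chi_square_difference_stein[OF V1 r l(1) indep H]
  note 2 = noncentral_chi_square_difference_stein[OF V2 r l(2) indep_var_swap[OF indep] bounded_derivs_reflect[OF K]]
  show ?thesis
    using has_bochner_integral_diff[OF 1 2]
    by (simp add: H_def K_def stein_operator_def eval_nat_numeral algebra_simps)
qed

text \<open>
  For a central \<open>V2\<close> the single factor \<open>S'\<close> replaces \<open>S'\<^sup>2\<close>, so now \<open>H = S' F\<close> and \<open>K = S\<^sup>2 F\<close>.
\<close>

lemma (in prob_space) chi_square_difference_stein_op2:
  assumes r: "r > 0" and l: "l1 \<ge> 0"
    and V1: "distributed M lborel V1 (\<lambda>x. ennreal (noncentral_chi_square_density r l1 x))"
    and V2: "distributed M lborel V2 (\<lambda>x. ennreal (noncentral_chi_square_density r 0 x))"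
    and indep: "indep_var borel V1 borel V2" and F: "bounded_derivs 3 F"
  shows "has_bochner_integral M (\<lambda>\<omega>. stein_operator (nth [1, -2, -4, 8])
     (nth [- l1, -(4 * r + 2 * l1), 8 * r, 0]) 3 F (V1 \<omega> - V2 \<omega>)) 0"
proof -
  define H where "H = (\<lambda>j x. \<Sum>i\<le>1. [1, 2] ! i * F (j + i) x)"
  define K where "K = (\<lambda>j x. \<Sum>i\<le>2. [1, -4, 4] ! i * F (j + i) x)"
  have H: "bounded_derivs 2 H" unfolding H_def by (rule bounded_derivs_comb) (use F in simp)
  have K: "bounded_derivs 1 K" unfolding K_def by (rule bounded_derivs_comb) (use F in \<open>simp add: eval_nat_numeral\<close>)
  note 1 = noncentral_chi_square_difference_stein[OF V1 r l(1) indep H]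
  note 2 = central_chi_square_difference_stein[OF V2 r indep_var_swap[OF indep] bounded_derivs_reflect[OF K]]
  show ?thesis
    using has_bochner_integral_diff[OF 1 2]
    by (simp add: H_def K_def stein_operator_def eval_nat_numeral algebra_simps)
qed

text \<open>
  If both variables are central, \<open>H = S' F\<close> and \<open>K = S F\<close>. The identity for \<open>V1\<close> is subtracted from that for \<open>V2\<close>
  because the operator is normalised with the opposite sign.
\<close>

lemma (in prob_space) chi_square_difference_stein_op3:
  assumes r: "r > 0"
    and V1: "distributed M lborel V1 (\<lambda>x. ennreal (noncentral_chi_square_density r 0 x))"
    and V2: "distributed M lborel V2 (\<lambda>x. ennreal (noncentral_chi_square_density r 0 x))"
    and indep: "indep_var borel V1 borel V2" and F: "bounded_derivs 2 F"
  shows "has_bochner_integral M (\<lambda>\<omega>. stein_operator (nth [-1, 0, 4]) (nth [0, 4 * r, 0]) 2 F (V1 \<omega> - V2 \<omega>)) 0"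
proof -
  define H where "H = (\<lambda>j x. \<Sum>i\<le>1. [1, 2] ! i * F (j + i) x)"
  define K where "K = (\<lambda>j x. \<Sum>i\<le>1. [1, -2] ! i * F (j + i) x)"
  have H: "bounded_derivs 1 H" unfolding H_def by (rule bounded_derivs_comb) (use F in \<open>simp add: eval_nat_numeral\<close>)
  have K: "bounded_derivs 1 K" unfolding K_def by (rule bounded_derivs_comb) (use F in \<open>simp add: eval_nat_numeral\<close>)
  note 1 = central_chi_square_difference_stein[OF V1 r indep H]
  note 2 = central_chi_square_difference_stein[OF V2 r indep_var_swap[OF indep] bounded_derivs_reflect[OF K]]
  show ?thesis
    using has_bochner_integral_diff[OF 2 1]
    by (simp add: H_def K_def stein_operator_def eval_nat_numeral algebra_simps)
qed

lemma one_plus_four_square_nonzero: "(1 + 4 * of_real t ^ 2 :: complex) \<noteq> 0" for t :: real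
proof -
  have "1 + 4 * t\<^sup>2 > 0" by (intro add_pos_nonneg) auto
  hence "of_real (1 + 4 * t\<^sup>2) \<noteq> (0 :: complex)" by (subst of_real_eq_0_iff) simp
  thus ?thesis by simp
qed

lemma one_minus_two_i_nonzero: "(1 - 2 * (\<i> * of_real t) :: complex) \<noteq> 0" for t :: real
  by (simp add: complex_eq_iff)

theorem corollary2p6:
  fixes M :: "'a measure" and N :: "'b measure"
    and V1 V2 T :: "'a \<Rightarrow> real" and W :: "'b \<Rightarrow> real"
    and r l1 l2 :: real
  assumes "prob_space M" and "prob_space N"
    and "r > 0" and "l1 \<ge> 0" and "l2 \<ge> 0"
    and "distributed M lborel V1 (\<lambda>x. ennreal (noncentral_chi_square_density r l1 x))"
    and "distributed M lborel V2 (\<lambda>x. ennreal (noncentral_chi_square_density r l2 x))"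
    and "prob_space.indep_var M borel V1 borel V2"
    and "T = (\<lambda>\<omega>. V1 \<omega> - V2 \<omega>)"
    and "W \<in> borel_measurable N" and "integrable N W"
  shows "(distr N borel W = distr M borel T \<longleftrightarrow>
            (\<forall>f\<in>stein_class M T 4. has_bochner_integral N (\<lambda>\<omega>. stein_op1 r l1 l2 f (W \<omega>)) 0))
       \<and> (l2 = 0 \<longrightarrow>
            (distr N borel W = distr M borel T \<longleftrightarrow>
              (\<forall>f\<in>stein_class M T 3. has_bochner_integral N (\<lambda>\<omega>. stein_op2 r l1 f (W \<omega>)) 0)))
       \<and> (l1 = 0 \<and> l2 = 0 \<longrightarrow>
            (distr N borel W = distr M borel T \<longleftrightarrow>
              (\<forall>f\<in>stein_class M T 2. has_bochner_integral N (\<lambda>\<omega>. stein_op3 r f (W \<omega>)) 0)))"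
proof -
  interpret prob_space M by (rule assms(1))
  have r: "r > 0" and l1: "l1 \<ge> 0" and l2: "l2 \<ge> 0" by (fact assms)+
  note V1 = assms(6) and V2 = assms(7) and indep = assms(8)
  have iT: "integrable M T"
    unfolding assms(9) using noncentral_chi_square_integrable[OF V1 r l1]
      noncentral_chi_square_integrable[OF V2 r l2] by (rule Bochner_Integration.integrable_diff)
  have T: "T \<omega> = V1 \<omega> - V2 \<omega>" for \<omega> by (simp add: assms(9))
  note char = stein_characterization[OF assms(1,2) iT assms(11)]
  have 1: "distr N borel W = distr M borel T \<longleftrightarrow>
      (\<forall>f\<in>stein_class M T 4. has_bochner_integral N (\<lambda>\<omega>. stein_op1 r l1 l2 f (W \<omega>)) 0)"
  proof -
    let ?a = "nth [1, 0, -8, 0, 16 :: real]"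
      and ?b = "nth [-(l1 - l2), -4 * (l1 + l2 + r), -4 * (l1 - l2), 16 * r, 0]"
    have op: "stein_op1 r l1 l2 f x = stein_operator ?a ?b 4 (\<lambda>j. (deriv ^^ j) f) x" for f x
      by (simp add: stein_op1_def stein_operator_def eval_nat_numeral algebra_simps)
    have "(\<Sum>j\<le>4. ?a j * (\<i> * t) ^ j) = (1 + 4 * of_real t ^ 2) ^ 2" for t :: real
      by (simp add: eval_nat_numeral algebra_simps)
    hence P: "(\<Sum>j\<le>4. ?a j * (\<i> * t) ^ j) \<noteq> 0" for t :: real
      using one_plus_four_square_nonzero[of t] by simp
    have H: "expectation (\<lambda>\<omega>. stein_operator ?a ?b 4 F (T \<omega>)) = 0" if "bounded_derivs 4 F" for F
      unfolding T using chi_square_difference_stein_op1[OF r l1 l2 V1 V2 indep that]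
      by (rule has_bochner_integral_integral_eq)
    show ?thesis unfolding op by (rule char[OF _ P H]) (simp_all add: eval_nat_numeral)
  qed
  have 2: "distr N borel W = distr M borel T \<longleftrightarrow>
      (\<forall>f\<in>stein_class M T 3. has_bochner_integral N (\<lambda>\<omega>. stein_op2 r l1 f (W \<omega>)) 0)" if l2_0: "l2 = 0"
  proof -
    let ?a = "nth [1, -2, -4, 8 :: real]" and ?b = "nth [- l1, -(4 * r + 2 * l1), 8 * r, 0]"
    have op: "stein_op2 r l1 f x = stein_operator ?a ?b 3 (\<lambda>j. (deriv ^^ j) f) x" for f x
      by (simp add: stein_op2_def stein_operator_def eval_nat_numeral algebra_simps)
    have "(\<Sum>j\<le>3. ?a j * (\<i> * t) ^ j) = (1 + 4 * of_real t ^ 2) * (1 - 2 * (\<i> * of_real t))" for t :: real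
      by (simp add: eval_nat_numeral algebra_simps)
    hence P: "(\<Sum>j\<le>3. ?a j * (\<i> * t) ^ j) \<noteq> 0" for t :: real
      using one_plus_four_square_nonzero[of t] one_minus_two_i_nonzero[of t] by simp
    have H: "expectation (\<lambda>\<omega>. stein_operator ?a ?b 3 F (T \<omega>)) = 0" if "bounded_derivs 3 F" for F
      unfolding T using chi_square_difference_stein_op2[OF r l1 V1 V2[unfolded l2_0] indep that]
      by (rule has_bochner_integral_integral_eq)
    show ?thesis unfolding op by (rule char[OF _ P H]) (simp_all add: eval_nat_numeral)
  qed
  have 3: "distr N borel W = distr M borel T \<longleftrightarrow>
      (\<forall>f\<in>stein_class M T 2. has_bochner_integral N (\<lambda>\<omega>. stein_op3 r f (W \<omega>)) 0)"
    if l1_0: "l1 = 0" and l2_0: "l2 = 0"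
  proof -
    let ?a = "nth [-1, 0, 4 :: real]" and ?b = "nth [0, 4 * r, 0]"
    have op: "stein_op3 r f x = stein_operator ?a ?b 2 (\<lambda>j. (deriv ^^ j) f) x" for f x
      by (simp add: stein_op3_def stein_operator_def eval_nat_numeral algebra_simps)
    have "(\<Sum>j\<le>2. ?a j * (\<i> * t) ^ j) = - (1 + 4 * of_real t ^ 2)" for t :: real
      by (simp add: eval_nat_numeral algebra_simps)
    hence P: "(\<Sum>j\<le>2. ?a j * (\<i> * t) ^ j) \<noteq> 0" for t :: real
      using one_plus_four_square_nonzero[of t] by (simp only: neg_equal_0_iff_equal) simp
    have H: "expectation (\<lambda>\<omega>. stein_operator ?a ?b 2 F (T \<omega>)) = 0" if "bounded_derivs 2 F" for F
      unfolding T using chi_square_difference_stein_op3[OF r V1[unfolded l1_0] V2[unfolded l2_0] indep that]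
      by (rule has_bochner_integral_integral_eq)
    show ?thesis unfolding op by (rule char[OF _ P H]) (simp_all add: eval_nat_numeral)
  qed
  show ?thesis using 1 2 3 by blast
qed

end
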